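(* Let $Q$ and $\widetilde Q$ be two isotropic elastic wave operators on $\Omega$ with parameters $(\lambda,\mu,\rho)$ and $(\widetilde\lambda,\widetilde\mu,\widetilde\rho)$, both piecewise smooth with the same interface $\Gamma$, with wave speeds $c_P,c_S$ and $\widetilde c_P,\widetilde c_S$, reflection operators $R,\widetilde R$ and transmission operators $T,\widetilde T$. Suppose that $R=\widetilde R$ modulo $\Psi^{-\infty}(\Gamma_-\times\mathbb R)$ and that $c_P=\widetilde c_P$, $c_S=\widetilde c_S$ and $\rho=\widetilde\rho$ in $\overline\Omega_-$. Then $T=\widetilde T$ modulo $\Psi^{-\infty}$.
   Context: $\Omega\subset\mathbb R^3$ is a bounded open domain with smooth boundary and $\Gamma\subset\Omega$ is a smooth closed connected hypersurface (the interface) that splits $\Omega$ into $\Omega_-$ (outside $\Gamma$) and $\Omega_+$ (inside $\Gamma$). $\Gamma_\pm$ denotes $\Gamma$ approached from $\Omega_\pm$; $p^{(\pm)}$ is the limit of a function $p$ at $\Gamma$ from $\Omega_\pm$; $\nu$ is a fixed unit normal to $\Gamma$. Elastic operator: for $u=(u_1,u_2,u_3)$, $Qu=\rho\,\partial_t^2u-\nabla_x\cdot\big(\lambda(\mathrm{div}\,u)\,\mathrm{Id}+2\mu\widehat\nabla u\big)$, where $\widehat\nabla u=(\nabla u+(\nabla u)^T)/2$. The density $\rho>0$ and Lamé parameters $\lambda,\mu$ are smooth on $\overline\Omega_-$ and on $\overline\Omega_+$, with possible jumps across $\Gamma$, and satisfy $\mu>0$, $3\lambda+2\mu>0$. Wave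 speeds: $c_P=\sqrt{(\lambda+2\mu)/\rho}$, $c_S=\sqrt{\mu/\rho}$. The transmission conditions are that $u$ and the normal stress $(\lambda(\mathrm{div}\,u)\mathrm{Id}+2\mu\widehat\nabla u)\nu$ have no jump across $\Gamma$. Reflection and transmission operators: microlocally near $\Gamma$, over hyperbolic points $(t,y,\tau,\xi')\in T^*(\mathbb R_t\times\Gamma)$, i.e. those with $|\xi'|<|\tau|/c$ for each $c\in\{c_P^{(\pm)},c_S^{(\pm)}\}$ (in particular away from the glancing set), a solution of $Qu=0$ has the form $u=u_I+u_R+u_T$. Here $u_I,u_R$ are supported in $\overline\Omega_-$, $u_T$ is supported in $\overline\Omega_+$, each solves the equation on its side modulo smooth functions, the singularities of the incident wave $u_I$ travel in $\Omega_-$ toward $\Gamma$ as $t$ increases, those of the reflected wave $u_R$ leave $\Gamma$ into $\Omega_-$, and those of the transmitted wave $u_T$ leave $\Gamma$ into $\Omega_+$; the transmission conditions hold on $\Gamma$ modulo $C^\infty$. With $h=u_I|_{\Gamma_-}$, the matrix-valued pseudodifferential operators $R$ and $T$ of order $0$ are determined modulo $\Psi^{-\infty}$ by $u_R|_{\Gamma_-}\equiv Rh$ and $u_T|_{\Gamma_+}\equiv Th$ modulo $C^\infty$. $\widetilde R,\widetilde T$ are the corresponding operators for $\widetilde Q$. Only hyperbolic points are considered. *)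

theory Defs
  imports "HOL-Analysis.Analysis"
begin

section \<open>Smooth functions\<close>

fun iter_deriv :: "'a::euclidean_space list \<Rightarrow> ('a \<Rightarrow> 'b::real_normed_vector) \<Rightarrow> 'a \<Rightarrow> 'b" where
  "iter_deriv [] f = f"
| "iter_deriv (v # vs) f = (\<lambda>x. frechet_derivative (iter_deriv vs f) (at x) v)"

text \<open>Only meant for open \<open>X\<close>; the values of \<open>f\<close> off \<open>X\<close> are then irrelevant.\<close>

definition smooth_on :: "'a::euclidean_space set \<Rightarrow> ('a \<Rightarrow> 'b::real_normed_vector) \<Rightarrow> bool" where
  "smooth_on X f \<longleftrightarrow>
     (\<forall>vs\<in>lists Basis. \<forall>x\<in>X. iter_deriv vs f differentiable (at x))"

definition smooth_upto :: "'a::euclidean_space set \<Rightarrow> ('a \<Rightarrow> 'b::real_normed_vector) \<Rightarrow> bool" where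
  "smooth_upto S f \<longleftrightarrow> (\<exists>U g. open U \<and> S \<subseteq> U \<and> smooth_on U g \<and> (\<forall>x\<in>S. g x = f x))"

definition grad :: "('a::euclidean_space \<Rightarrow> real) \<Rightarrow> 'a \<Rightarrow> 'a" where
  "grad f x = (\<Sum>b\<in>Basis. frechet_derivative f (at x) b *\<^sub>R b)"

definition supp :: "('a::euclidean_space \<Rightarrow> 'b::real_normed_vector) \<Rightarrow> 'a set" where
  "supp f = closure {x. f x \<noteq> 0}"

definition test_functions :: "'a::euclidean_space set \<Rightarrow> ('a \<Rightarrow> 'b::real_normed_vector) set" where
  "test_functions X = {\<phi>. smooth_on UNIV \<phi> \<and> compact (supp \<phi>) \<and> supp \<phi> \<subseteq> X}"


section \<open>Distributions and wave front sets on open subsets of a Euclidean space\<close>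

text \<open>A \<open>\<complex>\<^sup>3\<close>-valued distribution on the open set \<open>X\<close> is represented by a functional on all
  functions, of which only the values on \<open>test_functions X\<close> matter.\<close>

type_synonym 'a distr = "('a \<Rightarrow> complex) \<Rightarrow> complex"
type_synonym 'a vdistr = "('a \<Rightarrow> complex) \<Rightarrow> complex^3"

definition distribution :: "'a::euclidean_space set \<Rightarrow> 'a vdistr \<Rightarrow> bool" where
  "distribution X u \<longleftrightarrow>
     (\<forall>\<phi>\<in>test_functions X. \<forall>\<psi>\<in>test_functions X. u (\<lambda>x. \<phi> x + \<psi> x) = u \<phi> + u \<psi>) \<and>
     (\<forall>\<phi>\<in>test_functions X. \<forall>c. u (\<lambda>x. c * \<phi> x) = c *s u \<phi>) \<and>
     (\<forall>K. compact K \<and> K \<subseteq> X \<longrightarrow>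
        (\<exists>C N. \<forall>\<phi>\<in>test_functions X. \<forall>B. supp \<phi> \<subseteq> K \<and>
            (\<forall>vs\<in>lists Basis. length vs \<le> N \<longrightarrow> (\<forall>x. norm (iter_deriv vs \<phi> x) \<le> B))
            \<longrightarrow> norm (u \<phi>) \<le> C * B))"

definition density :: "('a::euclidean_space \<Rightarrow> complex^3) \<Rightarrow> 'a vdistr" where
  "density f \<phi> = (LINT x|lborel. \<phi> x *s f x)"

definition smooth_distribution :: "'a::euclidean_space set \<Rightarrow> 'a vdistr \<Rightarrow> bool" where
  "smooth_distribution X u \<longleftrightarrow>
     (\<exists>f. smooth_on X f \<and> (\<forall>\<phi>\<in>test_functions X. u \<phi> = density f \<phi>))"

definition supported_in :: "'a::euclidean_space set \<Rightarrow> 'a set \<Rightarrow> 'a vdistr \<Rightarrow> bool" where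
  "supported_in X S u \<longleftrightarrow> (\<forall>\<phi>\<in>test_functions X. supp \<phi> \<inter> S = {} \<longrightarrow> u \<phi> = 0)"

definition conic :: "'a::real_vector set \<Rightarrow> bool" where
  "conic W \<longleftrightarrow> (\<forall>\<xi>\<in>W. \<forall>r>0. r *\<^sub>R \<xi> \<in> W)"

text \<open>Covectors are identified with vectors through the inner product; the sign convention
  is such that \<open>exp (i x \<bullet> \<xi>)\<close> oscillates in the direction \<open>\<xi>\<close>.\<close>

definition wave_front :: "'a::euclidean_space set \<Rightarrow> 'a vdistr \<Rightarrow> ('a \<times> 'a) set" where
  "wave_front X u = {(x, \<xi>). x \<in> X \<and> \<xi> \<noteq> 0 \<and>
     \<not> (\<exists>\<theta>\<in>test_functions X. \<exists>W. \<theta> x \<noteq> 0 \<and> open W \<and> conic W \<and> \<xi> \<in> W \<and>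
          (\<forall>N::nat. \<exists>C. \<forall>\<eta>\<in>W.
             norm (u (\<lambda>y. \<theta> y * cis (- (y \<bullet> \<eta>)))) \<le> C / (1 + norm \<eta>) ^ N))}"

definition component :: "'a vdistr \<Rightarrow> 3 \<Rightarrow> 'a distr" where
  "component u i \<phi> = u \<phi> $ i"

definition dmult :: "('a \<Rightarrow> real) \<Rightarrow> 'a distr \<Rightarrow> 'a distr" where
  "dmult a w \<phi> = w (\<lambda>x. complex_of_real (a x) * \<phi> x)"

definition dderiv :: "'a::euclidean_space \<Rightarrow> 'a distr \<Rightarrow> 'a distr" where
  "dderiv v w \<phi> = - w (\<lambda>x. frechet_derivative \<phi> (at x) v)"


section \<open>The domain and the interface\<close>

definition smooth_domain :: "(real^3) set \<Rightarrow> bool" where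
  "smooth_domain \<Omega> \<longleftrightarrow> open \<Omega> \<and> connected \<Omega> \<and> bounded \<Omega> \<and> \<Omega> \<noteq> {} \<and>
     (\<forall>x\<in>frontier \<Omega>. \<exists>U r. open U \<and> x \<in> U \<and> smooth_on U r \<and>
        (\<forall>z\<in>U. grad r z \<noteq> 0) \<and> \<Omega> \<inter> U = {z\<in>U. r z < 0})"

text \<open>Inverses of charts of an embedded surface. The parameter domain need not be connected.\<close>

definition chart :: "(real^3) set \<Rightarrow> (real^2 \<Rightarrow> real^3) \<Rightarrow> (real^2) set \<Rightarrow> bool" where
  "chart \<Gamma> \<kappa> V \<longleftrightarrow> open V \<and> smooth_on V \<kappa> \<and>
     (\<forall>v\<in>V. inj (frechet_derivative \<kappa> (at v))) \<and>
     openin (top_of_set \<Gamma>) (\<kappa> ` V) \<and> (\<exists>g. homeomorphism V (\<kappa> ` V) \<kappa> g)"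

definition closed_surface :: "(real^3) set \<Rightarrow> bool" where
  "closed_surface \<Gamma> \<longleftrightarrow> compact \<Gamma> \<and> connected \<Gamma> \<and> \<Gamma> \<noteq> {} \<and>
     (\<forall>y\<in>\<Gamma>. \<exists>\<kappa> V. chart \<Gamma> \<kappa> V \<and> y \<in> \<kappa> ` V)"

definition unit_normal :: "(real^3) set \<Rightarrow> (real^3 \<Rightarrow> real^3) \<Rightarrow> bool" where
  "unit_normal \<Gamma> \<nu> \<longleftrightarrow> continuous_on \<Gamma> \<nu> \<and> (\<forall>y\<in>\<Gamma>. norm (\<nu> y) = 1) \<and>
     (\<forall>\<kappa> V. chart \<Gamma> \<kappa> V \<longrightarrow>
        (\<forall>v\<in>V. \<forall>w. \<nu> (\<kappa> v) \<bullet> frechet_derivative \<kappa> (at v) w = 0))"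

definition interface_geometry ::
  "(real^3) set \<Rightarrow> (real^3) set \<Rightarrow> (real^3 \<Rightarrow> real^3) \<Rightarrow> bool" where
  "interface_geometry \<Omega> \<Gamma> \<nu> \<longleftrightarrow>
     smooth_domain \<Omega> \<and> closed_surface \<Gamma> \<and> \<Gamma> \<subseteq> \<Omega> \<and> unit_normal \<Gamma> \<nu>"

text \<open>\<open>Minus\<close> is the side outside, \<open>Plus\<close> the side inside the interface.\<close>

datatype side = Minus | Plus

fun region :: "(real^3) set \<Rightarrow> (real^3) set \<Rightarrow> side \<Rightarrow> (real^3) set" where
  "region \<Omega> \<Gamma> Minus = \<Omega> \<inter> outside \<Gamma>"
| "region \<Omega> \<Gamma> Plus = \<Omega> \<inter> inside \<Gamma>"

definition collar :: "(real^3) set \<Rightarrow> (real^3) set \<Rightarrow> side \<Rightarrow> real \<Rightarrow> (real^3) set" where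
  "collar \<Omega> \<Gamma> s \<epsilon> = {x \<in> region \<Omega> \<Gamma> s. infdist x \<Gamma> < \<epsilon>}"


section \<open>Isotropic elasticity\<close>

text \<open>A piecewise smooth coefficient is a pair of functions, one for each side, smooth up to the
  boundary of that side; at points of the interface the value for side \<open>s\<close> is thus the
  one-sided limit.\<close>

record elastic =
  lam :: "side \<Rightarrow> real^3 \<Rightarrow> real"
  mu :: "side \<Rightarrow> real^3 \<Rightarrow> real"
  rho :: "side \<Rightarrow> real^3 \<Rightarrow> real"

definition elastic_parameters :: "(real^3) set \<Rightarrow> (real^3) set \<Rightarrow> elastic \<Rightarrow> bool" where
  "elastic_parameters \<Omega> \<Gamma> Q \<longleftrightarrow> (\<forall>s.
     smooth_upto (closure (region \<Omega> \<Gamma> s)) (lam Q s) \<and>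
     smooth_upto (closure (region \<Omega> \<Gamma> s)) (mu Q s) \<and>
     smooth_upto (closure (region \<Omega> \<Gamma> s)) (rho Q s) \<and>
     (\<forall>x\<in>closure (region \<Omega> \<Gamma> s).
        rho Q s x > 0 \<and> mu Q s x > 0 \<and> 3 * lam Q s x + 2 * mu Q s x > 0))"

definition c_P :: "elastic \<Rightarrow> side \<Rightarrow> real^3 \<Rightarrow> real" where
  "c_P Q s x = sqrt ((lam Q s x + 2 * mu Q s x) / rho Q s x)"

definition c_S :: "elastic \<Rightarrow> side \<Rightarrow> real^3 \<Rightarrow> real" where
  "c_S Q s x = sqrt (mu Q s x / rho Q s x)"

type_synonym spacetime = "real \<times> (real^3)"

definition D_t :: "spacetime distr \<Rightarrow> spacetime distr" where
  "D_t = dderiv (1, 0)"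

definition D_x :: "3 \<Rightarrow> spacetime distr \<Rightarrow> spacetime distr" where
  "D_x j = dderiv (0, axis j 1)"

definition stress ::
  "elastic \<Rightarrow> side \<Rightarrow> spacetime vdistr \<Rightarrow> 3 \<Rightarrow> 3 \<Rightarrow> spacetime distr" where
  "stress Q s u i j = (\<lambda>\<phi>.
     (if i = j then dmult (\<lambda>p. lam Q s (snd p)) (\<lambda>\<psi>. \<Sum>k\<in>UNIV. D_x k (component u k) \<psi>) \<phi> else 0) +
     dmult (\<lambda>p. 2 * mu Q s (snd p))
       (\<lambda>\<psi>. (D_x j (component u i) \<psi> + D_x i (component u j) \<psi>) / 2) \<phi>)"

definition elastic_op ::
  "elastic \<Rightarrow> side \<Rightarrow> spacetime vdistr \<Rightarrow> spacetime vdistr" where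
  "elastic_op Q s u = (\<lambda>\<phi>. \<chi> i.
     dmult (\<lambda>p. rho Q s (snd p)) (D_t (D_t (component u i))) \<phi> - (\<Sum>j\<in>UNIV. D_x j (stress Q s u i j) \<phi>))"


section \<open>Distributions on the lateral boundary\<close>

text \<open>The manifold \<open>\<real> \<times> \<Gamma>\<close> carries the product atlas, whose chart inverses are
  \<open>(t, v) \<mapsto> (t, \<kappa> v)\<close> on \<open>UNIV \<times> V\<close>. Test functions on it are normalised to vanish off
  \<open>\<real> \<times> \<Gamma>\<close>.\<close>

definition boundary_test :: "(real^3) set \<Rightarrow> (spacetime \<Rightarrow> complex) set" where
  "boundary_test \<Gamma> = {\<phi>.
     (\<forall>\<kappa> V. chart \<Gamma> \<kappa> V \<longrightarrow> smooth_on (UNIV \<times> V) (\<lambda>(t, v). \<phi> (t, \<kappa> v))) \<and>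
     (\<forall>t y. y \<notin> \<Gamma> \<longrightarrow> \<phi> (t, y) = 0) \<and>
     (\<exists>T. \<forall>t y. \<phi> (t, y) \<noteq> 0 \<longrightarrow> \<bar>t\<bar> \<le> T)}"

definition push ::
  "(real^2 \<Rightarrow> real^3) \<Rightarrow> (real^2) set \<Rightarrow> (real \<times> (real^2) \<Rightarrow> complex) \<Rightarrow> spacetime \<Rightarrow> complex" where
  "push \<kappa> V \<psi> = (\<lambda>(t, y). if y \<in> \<kappa> ` V then \<psi> (t, the_inv_into V \<kappa> y) else 0)"

text \<open>A function \<open>f\<close> on \<open>\<real> \<times> \<Gamma>\<close> is identified with the functional
  \<open>\<phi> \<mapsto> \<integral> \<phi> f dt dA\<close>, \<open>dA\<close> being the surface measure (this is the normalisation of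
  \<open>has_trace\<close> below). In a chart this becomes the function \<open>f (t, \<kappa> v) J v\<close> with the positive smooth
  surface density \<open>J\<close>; the notions of distribution, smoothness, wave front set and
  pseudodifferential operator are not affected by this factor, so \<open>J\<close> does not occur in them.\<close>

definition pull ::
  "(real^2 \<Rightarrow> real^3) \<Rightarrow> (real^2) set \<Rightarrow> spacetime vdistr \<Rightarrow> (real \<times> (real^2)) vdistr" where
  "pull \<kappa> V h = (\<lambda>\<psi>. h (push \<kappa> V \<psi>))"

definition boundary_distribution :: "(real^3) set \<Rightarrow> spacetime vdistr \<Rightarrow> bool" where
  "boundary_distribution \<Gamma> h \<longleftrightarrow>
     (\<forall>\<phi>\<in>boundary_test \<Gamma>. \<forall>\<psi>\<in>boundary_test \<Gamma>. h (\<lambda>z. \<phi> z + \<psi> z) = h \<phi> + h \<psi>) \<and>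
     (\<forall>\<phi>\<in>boundary_test \<Gamma>. \<forall>c. h (\<lambda>z. c * \<phi> z) = c *s h \<phi>) \<and>
     (\<forall>\<kappa> V. chart \<Gamma> \<kappa> V \<longrightarrow> distribution (UNIV \<times> V) (pull \<kappa> V h))"

definition boundary_smooth :: "(real^3) set \<Rightarrow> spacetime vdistr \<Rightarrow> bool" where
  "boundary_smooth \<Gamma> h \<longleftrightarrow>
     (\<forall>\<kappa> V. chart \<Gamma> \<kappa> V \<longrightarrow> smooth_distribution (UNIV \<times> V) (pull \<kappa> V h))"

definition supported_before :: "(real^3) set \<Rightarrow> real \<Rightarrow> spacetime vdistr \<Rightarrow> bool" where
  "supported_before \<Gamma> T h \<longleftrightarrow>
     (\<forall>\<phi>\<in>boundary_test \<Gamma>. (\<forall>t y. \<phi> (t, y) \<noteq> 0 \<longrightarrow> \<bar>t\<bar> > T) \<longrightarrow> h \<phi> = 0)"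

definition compact_distribution :: "(real^3) set \<Rightarrow> spacetime vdistr \<Rightarrow> bool" where
  "compact_distribution \<Gamma> h \<longleftrightarrow> boundary_distribution \<Gamma> h \<and> (\<exists>T. supported_before \<Gamma> T h)"

text \<open>A covector of \<open>\<real> \<times> \<Gamma>\<close> at \<open>(t, y)\<close> is a pair \<open>(\<tau>, \<xi>)\<close> with \<open>\<xi>\<close> tangent to
  \<open>\<Gamma>\<close> at \<open>y\<close>; its length is measured by the induced metric. Its coordinates in a chart are
  obtained with the adjoint of the differential of the chart inverse.\<close>

type_synonym bcovector = "spacetime \<times> spacetime"

definition boundary_wave_front ::
  "(real^3) set \<Rightarrow> (real^3 \<Rightarrow> real^3) \<Rightarrow> spacetime vdistr \<Rightarrow> bcovector set" where
  "boundary_wave_front \<Gamma> \<nu> h = {((t, y), (\<tau>, \<xi>)). y \<in> \<Gamma> \<and> \<xi> \<bullet> \<nu> y = 0 \<and>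
     (\<exists>\<kappa> V v. chart \<Gamma> \<kappa> V \<and> v \<in> V \<and> \<kappa> v = y \<and>
        ((t, v), (\<tau>, adjoint (frechet_derivative \<kappa> (at v)) \<xi>))
          \<in> wave_front (UNIV \<times> V) (pull \<kappa> V h))}"

definition hyperbolic ::
  "(real^3) set \<Rightarrow> (real^3 \<Rightarrow> real^3) \<Rightarrow> elastic \<Rightarrow> bcovector set" where
  "hyperbolic \<Gamma> \<nu> Q = {((t, y), (\<tau>, \<xi>)). y \<in> \<Gamma> \<and> \<xi> \<bullet> \<nu> y = 0 \<and>
     (\<forall>s. norm \<xi> < \<bar>\<tau>\<bar> / c_P Q s y \<and> norm \<xi> < \<bar>\<tau>\<bar> / c_S Q s y)}"


section \<open>Pseudodifferential operators on the lateral boundary\<close>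

definition symbols :: "real \<Rightarrow> ('a::euclidean_space \<times> 'a \<Rightarrow> complex^3^3) set" where
  "symbols m = {a. smooth_on UNIV a \<and>
     (\<forall>vs\<in>lists Basis. \<forall>ws\<in>lists Basis. \<exists>C. \<forall>z \<xi>.
        norm (iter_deriv (map (\<lambda>v. (v, 0)) vs @ map (\<lambda>w. (0, w)) ws) a (z, \<xi>))
          \<le> C * (1 + norm \<xi>) powr (m - real (length ws)))}"

definition fourier :: "('a::euclidean_space \<Rightarrow> complex^3) \<Rightarrow> 'a \<Rightarrow> complex^3" where
  "fourier f \<xi> = (LINT z|lborel. cis (- (z \<bullet> \<xi>)) *s f z)"

definition Op ::
  "('a::euclidean_space \<times> 'a \<Rightarrow> complex^3^3) \<Rightarrow> ('a \<Rightarrow> complex^3) \<Rightarrow> 'a \<Rightarrow> complex^3" where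
  "Op a f z = (1 / (2 * pi) ^ DIM('a)) *\<^sub>R
     (LINT \<xi>|lborel. cis (z \<bullet> \<xi>) *s (a (z, \<xi>) *v fourier f \<xi>))"

definition chart_density ::
  "(real^2 \<Rightarrow> real^3) \<Rightarrow> (real \<times> (real^2) \<Rightarrow> complex^3) \<Rightarrow> spacetime vdistr" where
  "chart_density \<kappa> f = (\<lambda>\<phi>. density f (\<lambda>(t, v). \<phi> (t, \<kappa> v)))"

type_synonym boundary_op = "spacetime vdistr \<Rightarrow> spacetime vdistr"

text \<open>Matrix-valued operators of order \<open>m\<close>: sequentially continuous linear maps from compactly
  supported distributions to distributions such that every localisation to a chart,
  \<open>f \<mapsto> \<phi> A (\<psi> f)\<close>, is a quantised symbol. As any two points of \<open>\<real> \<times> \<Gamma>\<close> lie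
  in a common (possibly disconnected) chart domain, this includes the smoothness of the kernel
  off the diagonal.\<close>

definition psido ::
  "(real^3) set \<Rightarrow> real \<Rightarrow> boundary_op \<Rightarrow> bool" where
  "psido \<Gamma> m A \<longleftrightarrow>
     (\<forall>h. compact_distribution \<Gamma> h \<longrightarrow> boundary_distribution \<Gamma> (A h)) \<and>
     (\<forall>h k. compact_distribution \<Gamma> h \<and> compact_distribution \<Gamma> k \<longrightarrow>
        (\<forall>\<phi>\<in>boundary_test \<Gamma>. A (\<lambda>\<psi>. h \<psi> + k \<psi>) \<phi> = A h \<phi> + A k \<phi>)) \<and>
     (\<forall>h c. compact_distribution \<Gamma> h \<longrightarrow>
        (\<forall>\<phi>\<in>boundary_test \<Gamma>. A (\<lambda>\<psi>. c *s h \<psi>) \<phi> = c *s A h \<phi>)) \<and>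
     (\<forall>H h T. (\<forall>n. compact_distribution \<Gamma> (H n) \<and> supported_before \<Gamma> T (H n)) \<and>
        compact_distribution \<Gamma> h \<and> (\<forall>\<phi>\<in>boundary_test \<Gamma>. (\<lambda>n. H n \<phi>) \<longlonglongrightarrow> h \<phi>) \<longrightarrow>
        (\<forall>\<phi>\<in>boundary_test \<Gamma>. (\<lambda>n::nat. A (H n) \<phi>) \<longlonglongrightarrow> A h \<phi>)) \<and>
     (\<forall>\<kappa> V \<phi> \<psi>. chart \<Gamma> \<kappa> V \<and> \<phi> \<in> test_functions (UNIV \<times> V) \<and> \<psi> \<in> test_functions (UNIV \<times> V) \<longrightarrow>
        (\<exists>a\<in>symbols m. \<forall>f\<in>test_functions UNIV. \<forall>g\<in>test_functions UNIV.
           pull \<kappa> V (A (chart_density \<kappa> (\<lambda>z. \<psi> z *s f z))) (\<lambda>z. \<phi> z * g z) = density (Op a f) g))"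

definition psido_smoothing ::
  "(real^3) set \<Rightarrow> boundary_op \<Rightarrow> bool" where
  "psido_smoothing \<Gamma> A \<longleftrightarrow> (\<forall>m. psido \<Gamma> m A)"

text \<open>Over the open cone \<open>H\<close> of hyperbolic points the operators are defined only microlocally:
  they act, modulo smooth functions, on compactly supported distributions with wave front set in
  \<open>H\<close>, and near each closed cone \<open>K\<close> in \<open>H\<close> with compact base they are represented by
  genuine pseudodifferential operators. Their symbols need not extend across the glancing set.\<close>

definition compact_cone :: "bcovector set \<Rightarrow> bool" where
  "compact_cone K \<longleftrightarrow>
     (\<forall>(p, \<zeta>)\<in>K. \<zeta> \<noteq> 0 \<and> (\<forall>r>0. (p, r *\<^sub>R \<zeta>) \<in> K)) \<and> compact {(p, \<zeta>)\<in>K. norm \<zeta> = 1}"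

definition represents ::
  "(real^3) set \<Rightarrow> (real^3 \<Rightarrow> real^3) \<Rightarrow> bcovector set \<Rightarrow>
     boundary_op \<Rightarrow>
     boundary_op \<Rightarrow> bool" where
  "represents \<Gamma> \<nu> K A R \<longleftrightarrow>
     (\<forall>h. compact_distribution \<Gamma> h \<and> boundary_wave_front \<Gamma> \<nu> h \<subseteq> K \<longrightarrow>
        boundary_smooth \<Gamma> (\<lambda>\<phi>. A h \<phi> - R h \<phi>))"

definition microlocal_psido ::
  "(real^3) set \<Rightarrow> (real^3 \<Rightarrow> real^3) \<Rightarrow> bcovector set \<Rightarrow> real \<Rightarrow>
     boundary_op \<Rightarrow> bool" where
  "microlocal_psido \<Gamma> \<nu> H m R \<longleftrightarrow>
     (\<forall>K. compact_cone K \<and> K \<subseteq> H \<longrightarrow> (\<exists>A. psido \<Gamma> m A \<and> represents \<Gamma> \<nu> K A R))"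

text \<open>Equality over \<open>H\<close> modulo smoothing operators, for operators of order 0.\<close>

definition equal_mod_smoothing ::
  "(real^3) set \<Rightarrow> (real^3 \<Rightarrow> real^3) \<Rightarrow> bcovector set \<Rightarrow>
     boundary_op \<Rightarrow>
     boundary_op \<Rightarrow> bool" where
  "equal_mod_smoothing \<Gamma> \<nu> H R R' \<longleftrightarrow>
     (\<forall>K. compact_cone K \<and> K \<subseteq> H \<longrightarrow>
        (\<exists>A A'. psido \<Gamma> 0 A \<and> represents \<Gamma> \<nu> K A R \<and> psido \<Gamma> 0 A' \<and> represents \<Gamma> \<nu> K A' R' \<and>
           psido_smoothing \<Gamma> (\<lambda>h \<phi>. A h \<phi> - A' h \<phi>)))"


section \<open>Traces on the two sides of the interface\<close>

text \<open>\<open>layer\<close> is \<open>\<psi>\<close>, extended to side \<open>s\<close> as constant along the normals, times a bump of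
  integral 1 concentrated at distance of order \<open>\<delta>\<close> from the interface. For \<open>w\<close> depending
  continuously on the distance to the interface, with values in distributions on the parallel
  surfaces, \<open>has_trace\<close> gives its limit at the interface.\<close>

definition layer ::
  "(real^3) set \<Rightarrow> (real^3) set \<Rightarrow> side \<Rightarrow> (real \<Rightarrow> complex) \<Rightarrow> real \<Rightarrow> (spacetime \<Rightarrow> complex) \<Rightarrow>
     spacetime \<Rightarrow> complex" where
  "layer \<Omega> \<Gamma> s \<theta> \<delta> \<psi> = (\<lambda>(t, x). if x \<in> region \<Omega> \<Gamma> s
     then \<psi> (t, closest_point \<Gamma> x) * \<theta> (infdist x \<Gamma> / \<delta>) / complex_of_real \<delta> else 0)"

definition has_trace ::
  "(real^3) set \<Rightarrow> (real^3) set \<Rightarrow> side \<Rightarrow> spacetime distr \<Rightarrow> spacetime distr \<Rightarrow> bool" where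
  "has_trace \<Omega> \<Gamma> s w h \<longleftrightarrow>
     (\<forall>\<psi>\<in>boundary_test \<Gamma>. \<forall>\<theta>\<in>test_functions {0<..}. (LINT r|lborel. \<theta> r) = 1 \<longrightarrow>
        ((\<lambda>\<delta>. w (layer \<Omega> \<Gamma> s \<theta> \<delta> \<psi>)) \<longlongrightarrow> h \<psi>) (at_right 0))"

definition displacement_trace ::
  "(real^3) set \<Rightarrow> (real^3) set \<Rightarrow> side \<Rightarrow> spacetime vdistr \<Rightarrow> spacetime vdistr \<Rightarrow> bool" where
  "displacement_trace \<Omega> \<Gamma> s u h \<longleftrightarrow>
     boundary_distribution \<Gamma> h \<and> (\<forall>i. has_trace \<Omega> \<Gamma> s (component u i) (component h i))"

definition traction_trace ::
  "(real^3) set \<Rightarrow> (real^3) set \<Rightarrow> (real^3 \<Rightarrow> real^3) \<Rightarrow> elastic \<Rightarrow> side \<Rightarrow>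
     spacetime vdistr \<Rightarrow> spacetime vdistr \<Rightarrow> bool" where
  "traction_trace \<Omega> \<Gamma> \<nu> Q s u k \<longleftrightarrow> boundary_distribution \<Gamma> k \<and>
     (\<exists>\<sigma>. (\<forall>i j. has_trace \<Omega> \<Gamma> s (stress Q s u i j) (\<sigma> i j)) \<and>
        (\<forall>\<phi>\<in>boundary_test \<Gamma>. \<forall>i.
           k \<phi> $ i = (\<Sum>j\<in>UNIV. dmult (\<lambda>p. \<nu> (snd p) $ j) (\<sigma> i j) \<phi>)))"


section \<open>Incident, reflected and transmitted waves\<close>

text \<open>Bicharacteristics of \<open>\<tau>\<^sup>2 - c\<^sup>2 \<bar>\<xi>\<bar>\<^sup>2\<close>, parametrised by time (\<open>\<tau>\<close> is conserved).\<close>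

definition bicharacteristic ::
  "(real^3 \<Rightarrow> real) \<Rightarrow> real \<Rightarrow> real set \<Rightarrow> (real \<Rightarrow> real^3) \<Rightarrow> (real \<Rightarrow> real^3) \<Rightarrow> bool" where
  "bicharacteristic c \<tau> I X \<Xi> \<longleftrightarrow> \<tau> \<noteq> 0 \<and> (\<forall>r\<in>I.
     \<bar>\<tau>\<bar> = c (X r) * norm (\<Xi> r) \<and>
     (X has_vector_derivative (- ((c (X r))\<^sup>2 / \<tau>)) *\<^sub>R \<Xi> r) (at r within I) \<and>
     (\<Xi> has_vector_derivative ((norm (\<Xi> r))\<^sup>2 / (2 * \<tau>)) *\<^sub>R grad (\<lambda>x. (c x)\<^sup>2) (X r)) (at r within I))"

definition incoming ::
  "(real^3) set \<Rightarrow> (real^3) set \<Rightarrow> elastic \<Rightarrow> side \<Rightarrow> real \<Rightarrow> bcovector set" where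
  "incoming \<Omega> \<Gamma> Q s \<epsilon> = {((t, x), (\<tau>, \<xi>)).
     \<exists>c\<in>{c_P Q s, c_S Q s}. \<exists>t1>t. \<exists>X \<Xi>.
       X t = x \<and> \<Xi> t = \<xi> \<and> bicharacteristic c \<tau> {t..<t1} X \<Xi> \<and>
       continuous_on {t..t1} X \<and> X ` {t..<t1} \<subseteq> collar \<Omega> \<Gamma> s \<epsilon> \<and> X t1 \<in> \<Gamma> \<and>
       strict_mono_on {t..t1} (\<lambda>r. - infdist (X r) \<Gamma>)}"

definition outgoing ::
  "(real^3) set \<Rightarrow> (real^3) set \<Rightarrow> elastic \<Rightarrow> side \<Rightarrow> real \<Rightarrow> bcovector set" where
  "outgoing \<Omega> \<Gamma> Q s \<epsilon> = {((t, x), (\<tau>, \<xi>)).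
     \<exists>c\<in>{c_P Q s, c_S Q s}. \<exists>t0<t. \<exists>X \<Xi>.
       X t = x \<and> \<Xi> t = \<xi> \<and> bicharacteristic c \<tau> {t0<..t} X \<Xi> \<and>
       continuous_on {t0..t} X \<and> X ` {t0<..t} \<subseteq> collar \<Omega> \<Gamma> s \<epsilon> \<and> X t0 \<in> \<Gamma> \<and>
       strict_mono_on {t0..t} (\<lambda>r. infdist (X r) \<Gamma>)}"

text \<open>A field supported on side \<open>s\<close> that solves the equation near the interface modulo functions
  smooth up to the interface, with singularities in \<open>D\<close>.\<close>

definition one_sided_wave ::
  "(real^3) set \<Rightarrow> (real^3) set \<Rightarrow> elastic \<Rightarrow> side \<Rightarrow> real \<Rightarrow> bcovector set \<Rightarrow>
     spacetime vdistr \<Rightarrow> bool" where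
  "one_sided_wave \<Omega> \<Gamma> Q s \<epsilon> D u \<longleftrightarrow>
     distribution (UNIV \<times> \<Omega>) u \<and>
     supported_in (UNIV \<times> \<Omega>) (UNIV \<times> closure (region \<Omega> \<Gamma> s)) u \<and>
     (\<exists>f. smooth_upto (UNIV \<times> (collar \<Omega> \<Gamma> s \<epsilon> \<union> \<Gamma>)) f \<and>
        (\<forall>\<phi>\<in>test_functions (UNIV \<times> collar \<Omega> \<Gamma> s \<epsilon>). elastic_op Q s u \<phi> = density f \<phi>)) \<and>
     wave_front (UNIV \<times> collar \<Omega> \<Gamma> s \<epsilon>) u \<subseteq> D"

text \<open>The microlocal solution \<open>u\<^sub>I + u\<^sub>R + u\<^sub>T\<close>, with displacement traces \<open>hI\<close>, \<open>hR\<close>, \<open>hT\<close>.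
  That all Cauchy data have wave front set over hyperbolic points excludes, e.g., Stoneley waves,
  which are singular at the interface but have no singularities in the interior.\<close>

definition scattering_solution ::
  "(real^3) set \<Rightarrow> (real^3) set \<Rightarrow> (real^3 \<Rightarrow> real^3) \<Rightarrow> elastic \<Rightarrow>
     spacetime vdistr \<Rightarrow> spacetime vdistr \<Rightarrow> spacetime vdistr \<Rightarrow>
     spacetime vdistr \<Rightarrow> spacetime vdistr \<Rightarrow> spacetime vdistr \<Rightarrow> bool" where
  "scattering_solution \<Omega> \<Gamma> \<nu> Q uI uR uT hI hR hT \<longleftrightarrow>
     (\<exists>\<epsilon>>0.
        one_sided_wave \<Omega> \<Gamma> Q Minus \<epsilon> (incoming \<Omega> \<Gamma> Q Minus \<epsilon>) uI \<and>
        one_sided_wave \<Omega> \<Gamma> Q Minus \<epsilon> (outgoing \<Omega> \<Gamma> Q Minus \<epsilon>) uR \<and>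
        one_sided_wave \<Omega> \<Gamma> Q Plus \<epsilon> (outgoing \<Omega> \<Gamma> Q Plus \<epsilon>) uT) \<and>
     displacement_trace \<Omega> \<Gamma> Minus uI hI \<and>
     displacement_trace \<Omega> \<Gamma> Minus uR hR \<and>
     displacement_trace \<Omega> \<Gamma> Plus uT hT \<and>
     boundary_smooth \<Gamma> (\<lambda>\<phi>. hI \<phi> + hR \<phi> - hT \<phi>) \<and>
     (\<exists>kI kR kT.
        traction_trace \<Omega> \<Gamma> \<nu> Q Minus uI kI \<and>
        traction_trace \<Omega> \<Gamma> \<nu> Q Minus uR kR \<and>
        traction_trace \<Omega> \<Gamma> \<nu> Q Plus uT kT \<and>
        boundary_smooth \<Gamma> (\<lambda>\<phi>. kI \<phi> + kR \<phi> - kT \<phi>) \<and>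
        (\<forall>h\<in>{hI, hR, hT, kI, kR, kT}. boundary_wave_front \<Gamma> \<nu> h \<subseteq> hyperbolic \<Gamma> \<nu> Q))"

text \<open>The operators are determined by the solutions with incident trace \<open>h\<close>, for arbitrary \<open>h\<close>
  over hyperbolic points; that such solutions exist is part of the operators being defined.\<close>

definition reflection_operator ::
  "(real^3) set \<Rightarrow> (real^3) set \<Rightarrow> (real^3 \<Rightarrow> real^3) \<Rightarrow> elastic \<Rightarrow>
     boundary_op \<Rightarrow> bool" where
  "reflection_operator \<Omega> \<Gamma> \<nu> Q R \<longleftrightarrow> microlocal_psido \<Gamma> \<nu> (hyperbolic \<Gamma> \<nu> Q) 0 R \<and>
     (\<forall>h. compact_distribution \<Gamma> h \<and> boundary_wave_front \<Gamma> \<nu> h \<subseteq> hyperbolic \<Gamma> \<nu> Q \<longrightarrow>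
        (\<exists>uI uR uT hR hT. scattering_solution \<Omega> \<Gamma> \<nu> Q uI uR uT h hR hT) \<and>
        (\<forall>uI uR uT hR hT. scattering_solution \<Omega> \<Gamma> \<nu> Q uI uR uT h hR hT \<longrightarrow>
           boundary_smooth \<Gamma> (\<lambda>\<phi>. hR \<phi> - R h \<phi>)))"

definition transmission_operator ::
  "(real^3) set \<Rightarrow> (real^3) set \<Rightarrow> (real^3 \<Rightarrow> real^3) \<Rightarrow> elastic \<Rightarrow>
     boundary_op \<Rightarrow> bool" where
  "transmission_operator \<Omega> \<Gamma> \<nu> Q T \<longleftrightarrow> microlocal_psido \<Gamma> \<nu> (hyperbolic \<Gamma> \<nu> Q) 0 T \<and>
     (\<forall>h. compact_distribution \<Gamma> h \<and> boundary_wave_front \<Gamma> \<nu> h \<subseteq> hyperbolic \<Gamma> \<nu> Q \<longrightarrow>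
        (\<exists>uI uR uT hR hT. scattering_solution \<Omega> \<Gamma> \<nu> Q uI uR uT h hR hT) \<and>
        (\<forall>uI uR uT hR hT. scattering_solution \<Omega> \<Gamma> \<nu> Q uI uR uT h hR hT \<longrightarrow>
           boundary_smooth \<Gamma> (\<lambda>\<phi>. hT \<phi> - T h \<phi>)))"

end

(* The displacement is continuous across the interface, so the traces satisfy
   h_I + h_R = h_T modulo smooth functions, which says T = Id + R over the hyperbolic points, and
   likewise T' = Id + R'.  Hence T - T' = R - R'.  If A represents T on a cone K, and B, B' represent
   R, R' with B - B' smoothing, then A - (B - B') represents T'.  It remains to see that
   pseudodifferential operators of order 0 form a vector space.  Since an oscillatory integral that
   does not converge absolutely is 0 by the convention for non-integrable functions, additivity of
   the quantisation in the symbol needs the Fourier transform of a test function to be integrable. *)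

theory Submission
  imports Defs "HOL-Probability.Sinc_Integral"
begin


section \<open>Smooth functions and test functions\<close>

lemma has_derivative_iter_deriv:
  assumes "smooth_on X f" "vs \<in> lists Basis" "x \<in> X"
  shows "(iter_deriv vs f has_derivative frechet_derivative (iter_deriv vs f) (at x)) (at x)"
  using assms unfolding smooth_on_def by (meson frechet_derivative_works)

text \<open>\<open>frechet_derivative\<close> is linear only at points where both functions are
  differentiable, hence the smoothness assumptions. In the induction the identity is known on all of
  the open set \<open>X\<close>, hence near \<open>x\<close>, so it may be differentiated once more.
  The scalar \<open>c\<close> covers sums (\<open>c = 1\<close>) and differences
  (\<open>c = - 1\<close>) at once.\<close>

lemma iter_deriv_lincomb:
  fixes f g :: "'a::euclidean_space \<Rightarrow> 'b::real_normed_vector"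
  assumes X: "open X" and f: "smooth_on X f" and g: "smooth_on X g"
    and "vs \<in> lists Basis" "x \<in> X"
  shows "iter_deriv vs (\<lambda>x. f x + c *\<^sub>R g x) x = iter_deriv vs f x + c *\<^sub>R iter_deriv vs g x"
  using assms(4,5)
proof (induction vs arbitrary: x rule: list.induct)
  case (Cons v vs)
  have vs: "vs \<in> lists Basis"
    using Cons.prems by simp
  have "((\<lambda>x. iter_deriv vs f x + c *\<^sub>R iter_deriv vs g x) has_derivative
      (\<lambda>h. frechet_derivative (iter_deriv vs f) (at x) h
         + c *\<^sub>R frechet_derivative (iter_deriv vs g) (at x) h)) (at x)"
    by (intro has_derivative_add has_derivative_scaleR_right has_derivative_iter_deriv[OF f vs]
        has_derivative_iter_deriv[OF g vs] Cons.prems)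
  then have "(iter_deriv vs (\<lambda>x. f x + c *\<^sub>R g x) has_derivative
      (\<lambda>h. frechet_derivative (iter_deriv vs f) (at x) h
         + c *\<^sub>R frechet_derivative (iter_deriv vs g) (at x) h)) (at x)"
    by (rule has_derivative_transform_within_open[OF _ X Cons.prems(2)])
       (rule Cons.IH[OF vs, symmetric])
  from fun_cong[OF frechet_derivative_at[OF this], of v] show ?case
    by simp
qed simp

lemma smooth_on_lincomb:
  fixes f g :: "'a::euclidean_space \<Rightarrow> 'b::real_normed_vector"
  assumes X: "open X" and f: "smooth_on X f" and g: "smooth_on X g"
  shows "smooth_on X (\<lambda>x. f x + c *\<^sub>R g x)"
  unfolding smooth_on_def
proof (intro ballI)
  fix vs x assume vs: "vs \<in> lists (Basis :: 'a set)" and x: "x \<in> X"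
  have "((\<lambda>x. iter_deriv vs f x + c *\<^sub>R iter_deriv vs g x) has_derivative
      (\<lambda>h. frechet_derivative (iter_deriv vs f) (at x) h
         + c *\<^sub>R frechet_derivative (iter_deriv vs g) (at x) h)) (at x)"
    by (intro has_derivative_add has_derivative_scaleR_right has_derivative_iter_deriv[OF f vs x]
        has_derivative_iter_deriv[OF g vs x])
  then have "(iter_deriv vs (\<lambda>x. f x + c *\<^sub>R g x) has_derivative
      (\<lambda>h. frechet_derivative (iter_deriv vs f) (at x) h
         + c *\<^sub>R frechet_derivative (iter_deriv vs g) (at x) h)) (at x)"
    by (rule has_derivative_transform_within_open[OF _ X x])
       (simp add: iter_deriv_lincomb[OF X f g vs])
  then show "iter_deriv vs (\<lambda>x. f x + c *\<^sub>R g x) differentiable at x"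
    by (auto simp: differentiable_def)
qed

lemma iter_deriv_append: "iter_deriv vs (iter_deriv ws f) = iter_deriv (vs @ ws) f"
  by (induction vs) auto

lemma smooth_on_iter_deriv:
  assumes "smooth_on X f" "ws \<in> lists Basis"
  shows "smooth_on X (iter_deriv ws f)"
  using assms by (simp add: smooth_on_def iter_deriv_append)

lemma smooth_on_imp_continuous_on:
  assumes "smooth_on X f"
  shows "continuous_on X f"
proof (rule differentiable_imp_continuous_on)
  have "f differentiable (at x)" if "x \<in> X" for x
    using assms that unfolding smooth_on_def by (auto dest!: bspec[of _ _ "[]"])
  then show "f differentiable_on X"
    by (simp add: differentiable_on_def differentiable_at_withinI)
qed

section \<open>Supports, and closure of test functions under derivatives and linear
  combinations\<close>

lemma not_in_supp: "x \<notin> supp f \<Longrightarrow> f x = 0"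
  using closure_subset[of "{x. f x \<noteq> 0}"] by (auto simp: supp_def)

lemma supp_minimal: "closed S \<Longrightarrow> (\<And>x. x \<notin> S \<Longrightarrow> f x = 0) \<Longrightarrow> supp f \<subseteq> S"
  using closure_minimal[of "{x. f x \<noteq> 0}" S] by (auto simp: supp_def)

text \<open>The complement of \<open>supp f\<close> is open and \<open>f\<close> vanishes on it, so
  near such a point \<open>f\<close> is constant and its derivative is the zero map.\<close>

lemma supp_frechet_derivative: "supp (\<lambda>x. frechet_derivative f (at x) v) \<subseteq> supp f"
proof (rule supp_minimal)
  fix x assume x: "x \<notin> supp f"
  have "open (- supp f)"
    by (simp add: supp_def open_Compl)
  then have "(f has_derivative (\<lambda>_. 0)) (at x)"
    by (rule has_derivative_transform_within_open[OF has_derivative_const]) (simp_all add: x not_in_supp)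
  from fun_cong[OF frechet_derivative_at[OF this], of v] show "frechet_derivative f (at x) v = 0"
    by simp
qed (simp add: supp_def)

lemma supp_iter_deriv: "supp (iter_deriv vs f) \<subseteq> supp f"
proof (induction vs)
  case (Cons v vs)
  then show ?case
    using supp_frechet_derivative[of "iter_deriv vs f" v] by auto
qed simp

lemma test_functions_iter_deriv:
  assumes "f \<in> test_functions X" "vs \<in> lists Basis"
  shows "iter_deriv vs f \<in> test_functions X"
proof -
  have "compact (supp (iter_deriv vs f))"
    using assms supp_iter_deriv[of vs f] compact_Int_closed[of "supp f" "supp (iter_deriv vs f)"]
    by (simp add: test_functions_def inf.absorb2 supp_def)
  then show ?thesis
    using assms supp_iter_deriv[of vs f] smooth_on_iter_deriv[of UNIV f vs]
    by (auto simp: test_functions_def)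
qed

lemma test_functions_lincomb:
  fixes f g :: "'a::euclidean_space \<Rightarrow> 'b::real_normed_vector"
  assumes "f \<in> test_functions X" "g \<in> test_functions X"
  shows "(\<lambda>x. f x + c *\<^sub>R g x) \<in> test_functions X"
proof -
  have s: "supp (\<lambda>x. f x + c *\<^sub>R g x) \<subseteq> supp f \<union> supp g"
  proof (rule supp_minimal)
    show "closed (supp f \<union> supp g)"
      by (simp add: supp_def closed_Un)
  qed (simp add: not_in_supp)
  then have "compact (supp (\<lambda>x. f x + c *\<^sub>R g x))"
    using assms compact_Int_closed[of "supp f \<union> supp g" "supp (\<lambda>x. f x + c *\<^sub>R g x)"]
    by (simp add: test_functions_def inf.absorb2 supp_def compact_Un)
  then show ?thesis
    using s assms smooth_on_lincomb[of UNIV f g c] by (auto simp: test_functions_def)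
qed

section \<open>Integrals of compactly supported functions and of their derivatives\<close>

lemma integrable_compact_supp:
  fixes f :: "'a::euclidean_space \<Rightarrow> 'b::{banach, second_countable_topology}"
  assumes "compact K" "continuous_on K f" "\<And>x. x \<notin> K \<Longrightarrow> f x = 0"
  shows "integrable lborel f"
proof -
  \<comment> \<open>Continuity is given on \<open>K\<close> alone, so the integrand is first
    rewritten as its own restriction to \<open>K\<close>.\<close>
  have "(\<lambda>x. indicator K x *\<^sub>R f x) = f"
    using assms(3) by (auto simp: fun_eq_iff indicator_def)
  then show ?thesis
    using borel_integrable_compact[OF assms(1,2)] by simp
qed


text \<open>The core of integration by parts. Difference quotients of \<open>f\<close> in direction
  \<open>b\<close> have integral 0 by translation invariance of Lebesgue measure, and they converge
  to the derivative under a common integrable bound.\<close>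

lemma integral_directional_derivative_eq_0:
  fixes f :: "'a::euclidean_space \<Rightarrow> 'b::{banach, second_countable_topology}"
  assumes D: "\<And>x. (f has_derivative D x) (at x)"
    and cont: "continuous_on UNIV (\<lambda>x. D x b)"
    and K: "compact K" and f0: "\<And>x. x \<notin> K \<Longrightarrow> f x = 0"
  shows "(LINT x|lborel. D x b) = 0"
proof -
  have cf: "continuous_on UNIV f"
    using D by (meson continuous_at_imp_continuous_on has_derivative_continuous)
  have intf: "integrable lborel f"
    using integrable_compact_supp[OF K] cf f0 continuous_on_subset by blast
  obtain R where R: "\<And>x. x \<in> K \<Longrightarrow> norm x \<le> R"
    using compact_imp_bounded[OF K] by (auto simp: bounded_iff)
  have D0: "D x b = 0" if "x \<notin> K" for x
  proof -
    have "(f has_derivative (\<lambda>_. 0)) (at x)"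
      by (rule has_derivative_transform_within_open[of "\<lambda>_. 0" _ _ _ "- K"])
         (use that f0 compact_imp_closed[OF K] in auto)
    then show ?thesis
      using has_derivative_unique[OF D] by (metis)
  qed
  have "bounded ((\<lambda>x. D x b) ` K)"
    using K cont by (meson compact_continuous_image continuous_on_subset subset_UNIV compact_imp_bounded)
  then obtain M0 where M0: "\<And>x. x \<in> K \<Longrightarrow> norm (D x b) \<le> M0"
    by (auto simp: bounded_iff)
  \<comment> \<open>If \<open>K\<close> is empty, \<open>M0\<close> may be negative; the maximum
    makes \<open>M\<close> a nonnegative bound on the whole space.\<close>
  define M where "M = max M0 0"
  have M: "norm (D x b) \<le> M" for x
    using M0[of x] D0[of x] by (cases "x \<in> K") (simp_all add: M_def)
  have M_nonneg: "0 \<le> M"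
    by (simp add: M_def)
  \<comment> \<open>Step sizes \<open>1 / (n + 1)\<close>: positive, tending to 0, and at most 1, so
    that a shift by \<open>e n *\<^sub>R b\<close> is no longer than \<open>b\<close>.\<close>
  define e where "e n = inverse (real (Suc n))" for n
  have e: "0 < e n" "e n \<le> 1" for n
    by (simp_all add: e_def inverse_eq_divide)
  define q where "q n x = (f (e n *\<^sub>R b + x) - f x) /\<^sub>R e n" for n x
  \<comment> \<open>The restriction of \<open>f\<close> to a line in direction \<open>b\<close>
    serves twice: for the mean value bound on \<open>q n x\<close> and for its limit.\<close>
  have line: "((\<lambda>s. f (s *\<^sub>R b + x)) has_derivative (\<lambda>h. h *\<^sub>R D (s *\<^sub>R b + x) b)) (at s within S)"
    for s x S
  proof -
    have "((f \<circ> (\<lambda>s. s *\<^sub>R b + x)) has_derivative (D (s *\<^sub>R b + x) \<circ> (\<lambda>h. h *\<^sub>R b))) (at s)"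
      by (rule diff_chain_at[OF _ D]) (auto intro!: derivative_eq_intros)
    then show ?thesis
      using linear_cmul[OF has_derivative_linear[OF D[of "s *\<^sub>R b + x"]]]
      by (simp add: o_def has_derivative_at_withinI)
  qed
  have q_bound: "norm (q n x) \<le> indicator (cball 0 (R + norm b)) x * M" for n x
  proof (cases "x \<in> cball 0 (R + norm b)")
    case True
    have "norm (f (e n *\<^sub>R b + x) - f (0 *\<^sub>R b + x)) \<le> M * norm (e n - 0)"
    proof (rule differentiable_bound[OF convex_UNIV line])
      show "onorm (\<lambda>h. h *\<^sub>R D (s *\<^sub>R b + x) b) \<le> M" for s
        by (rule onorm_bound) (simp_all add: M M_nonneg mult.commute[of M] mult_left_mono)
    qed simp_all
    moreover have "norm (q n x) = norm (f (e n *\<^sub>R b + x) - f x) / e n"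
      using e[of n] by (simp add: q_def divide_inverse_commute)
    ultimately show ?thesis
      using True e[of n] by (simp add: pos_divide_le_eq)
  next
    case False
    \<comment> \<open>Outside the enlarged ball neither \<open>x\<close> nor the shifted point can
      lie in \<open>K\<close>, so the quotient is 0 there.\<close>
    have "norm (e n *\<^sub>R b) \<le> norm b"
      using e[of n] by (simp add: mult_left_le_one_le)
    then have "norm (e n *\<^sub>R b + x) > R" "norm x > R"
      using False norm_diff_ineq[of x "e n *\<^sub>R b"] norm_ge_zero[of b]
      unfolding add.commute[of x] mem_cball_0 by linarith+
    then have "e n *\<^sub>R b + x \<notin> K" "x \<notin> K"
      using R by (meson not_le)+
    then show ?thesis
      using False f0 by (simp add: q_def)
  qed
  have q_lim: "(\<lambda>n. q n x) \<longlonglongrightarrow> D x b" for x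
  proof -
    let ?r = "\<lambda>h. f (h *\<^sub>R b + x) - f x - h *\<^sub>R D x b"
    have "((\<lambda>h. norm (?r h /\<^sub>R norm h)) \<longlongrightarrow> 0) (at 0)"
      using line[of x 0 UNIV] unfolding has_derivative_at_within by (intro tendsto_norm_zero) simp
    then have "((\<lambda>h. norm ((f (h *\<^sub>R b + x) - f x) /\<^sub>R h - D x b)) \<longlongrightarrow> 0) (at 0)"
    proof (rule Lim_transform_eventually)
      \<comment> \<open>Dividing by \<open>norm h\<close> or by \<open>h\<close> changes at most a
        sign, so the remainder estimate in the definition of the derivative becomes convergence of
        the two-sided difference quotient.\<close>
      have "norm (?r h /\<^sub>R norm h) = norm ((f (h *\<^sub>R b + x) - f x) /\<^sub>R h - D x b)" if "h \<noteq> 0" for h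
      proof -
        have "norm (?r h /\<^sub>R norm h) = norm (?r h /\<^sub>R h)"
          by simp
        also have "?r h /\<^sub>R h = (f (h *\<^sub>R b + x) - f x) /\<^sub>R h - D x b"
          using that by (simp add: scaleR_right_diff_distrib)
        finally show ?thesis .
      qed
      then show "\<forall>\<^sub>F h in at 0. norm (?r h /\<^sub>R norm h) =
          norm ((f (h *\<^sub>R b + x) - f x) /\<^sub>R h - D x b)"
        by (simp add: eventually_at_filter)
    qed
    then have "((\<lambda>h. (f (h *\<^sub>R b + x) - f x) /\<^sub>R h) \<longlongrightarrow> D x b) (at 0)"
      by (rule LIM_zero_cancel[OF tendsto_norm_zero_cancel])
    moreover have "filterlim e (at 0) sequentially"
      using LIMSEQ_inverse_real_of_nat by (simp add: filterlim_at e_def[abs_def])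
    ultimately show ?thesis
      unfolding q_def by (rule filterlim_compose[where f=e])
  qed
  \<comment> \<open>Lebesgue measure is its own image under translation by \<open>c\<close>.\<close>
  have intfs: "integrable lborel (\<lambda>x. f (c + x))" and
    eqfs: "(LINT x|lborel. f (c + x)) = (LINT x|lborel. f x)" for c
    using intf integrable_distr[of "(+) c" lborel borel f] integral_distr[of "(+) c" lborel borel f]
    by (simp_all add: lborel_distr_plus borel_measurable_continuous_onI[OF cf])
  have q0: "(LINT x|lborel. q n x) = 0" for n
    unfolding q_def using intfs intf eqfs by simp
  have "(\<lambda>n. LINT x|lborel. q n x) \<longlonglongrightarrow> (LINT x|lborel. D x b)"
  proof (rule integral_dominated_convergence)
    show "(\<lambda>x. D x b) \<in> borel_measurable lborel"
      using borel_measurable_continuous_onI[OF cont] by simp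
    show "q n \<in> borel_measurable lborel" for n
      unfolding q_def using borel_measurable_integrable[OF intfs] borel_measurable_integrable[OF intf]
      by measurable
    show "integrable lborel (\<lambda>x::'a. indicator (cball 0 (R + norm b)) x * M)"
      by (intro integrable_mult_left integrable_real_indicator) (use emeasure_bounded_finite[OF bounded_cball] in simp_all)
  qed (simp_all add: q_lim q_bound)
  then show ?thesis
    by (simp add: q0 LIMSEQ_const_iff)
qed


section \<open>Integrability of the Fourier transform\<close>

lemma norm_vector_smult: "norm (c *s x) = norm c * norm x"
  for c :: "'a::real_normed_field" and x :: "'a^'n"
  by (simp add: norm_vec_def L2_set_def norm_mult power_mult_distrib real_sqrt_mult
      flip: sum_distrib_left)

text \<open>Viewed as a bounded bilinear map over the reals, \<open>*s\<close> obtains continuity,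
  the product rule for derivatives and the exchange with integrals.\<close>

lemma bounded_bilinear_vector_smult:
  "bounded_bilinear ((*s) :: complex \<Rightarrow> complex^'n \<Rightarrow> complex^'n)"
proof
  show "\<exists>K. \<forall>(a::complex) (b::complex^'n). norm (a *s b) \<le> norm a * norm b * K"
    by (rule exI[of _ 1]) (simp add: norm_vector_smult)
qed (simp_all add: vec_eq_iff algebra_simps)

text \<open>In finite dimensions bilinearity already implies boundedness.\<close>

lemma bounded_bilinear_matrix_vector_mult:
  "bounded_bilinear ((*v) :: complex^'n^'m \<Rightarrow> complex^'n \<Rightarrow> complex^'m)"
  by (simp add: bilinear_def linear_iff vec_eq_iff matrix_vector_mult_def sum.distrib
      scaleR_sum_right algebra_simps flip: bilinear_conv_bounded_bilinear)

lemmas continuous_on_vector_smult [continuous_intros] =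
  bounded_bilinear.continuous_on[OF bounded_bilinear_vector_smult]

lemmas continuous_on_matrix_vector_mult [continuous_intros] =
  bounded_bilinear.continuous_on[OF bounded_bilinear_matrix_vector_mult]

lemma test_functionsD:
  assumes "f \<in> test_functions X"
  shows "compact (supp f)" "supp f \<subseteq> X" "continuous_on UNIV f"
  using assms smooth_on_imp_continuous_on by (auto simp: test_functions_def)

lemma integrable_smult_test_function:
  fixes f :: "'a::euclidean_space \<Rightarrow> complex^'n"
  assumes \<phi>: "\<phi> \<in> test_functions X" and f: "continuous_on X f"
  shows "integrable lborel (\<lambda>x. \<phi> x *s f x)"
proof (rule integrable_compact_supp)
  show "compact (supp \<phi>)"
    using \<phi> test_functionsD by blast
  show "continuous_on (supp \<phi>) (\<lambda>x. \<phi> x *s f x)"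
    using test_functionsD[OF \<phi>] f
    by (auto intro!: continuous_intros elim: continuous_on_subset)
qed (simp add: not_in_supp)

lemma integrable_test_function:
  fixes f :: "'a::euclidean_space \<Rightarrow> 'b::{banach, second_countable_topology}"
  assumes "f \<in> test_functions X"
  shows "integrable lborel f"
  by (rule integrable_compact_supp[of "supp f"])
     (use test_functionsD[OF assms] in \<open>auto intro: continuous_on_subset not_in_supp\<close>)

lemma integrable_fourier_integrand:
  fixes f :: "'a::euclidean_space \<Rightarrow> complex^3"
  assumes "f \<in> test_functions X"
  shows "integrable lborel (\<lambda>z. cis (- (z \<bullet> \<xi>)) *s f z)"
proof (rule integrable_compact_supp[of "supp f"])
  show "continuous_on (supp f) (\<lambda>z. cis (- (z \<bullet> \<xi>)) *s f z)"
    using test_functionsD[OF assms]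
    by (auto intro!: continuous_intros elim: continuous_on_subset)
qed (use test_functionsD[OF assms] in \<open>simp_all add: not_in_supp\<close>)

lemma fourier_lincomb:
  fixes f g :: "'a::euclidean_space \<Rightarrow> complex^3"
  assumes "f \<in> test_functions X" "g \<in> test_functions X"
  shows "fourier (\<lambda>z. f z + c *\<^sub>R g z) \<xi> = fourier f \<xi> + c *\<^sub>R fourier g \<xi>"
proof -
  interpret s: bounded_bilinear "(*s) :: complex \<Rightarrow> complex^3 \<Rightarrow> complex^3"
    by (rule bounded_bilinear_vector_smult)
  show ?thesis
    using assms[THEN integrable_fourier_integrand, of \<xi>]
    by (simp add: fourier_def s.add_right s.scaleR_right)
qed

text \<open>Integration by parts: the derivative in direction \<open>b\<close> of the exponential
  times \<open>f\<close> has integral 0, and the exponential contributes the factor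
  \<open>- \<i> * (b \<bullet> \<xi>)\<close>.\<close>

lemma fourier_directional_derivative:
  fixes f :: "'a::euclidean_space \<Rightarrow> complex^3"
  assumes f: "f \<in> test_functions X" and b: "b \<in> Basis"
  shows "fourier (iter_deriv [b] f) \<xi> = (\<i> * complex_of_real (b \<bullet> \<xi>)) *s fourier f \<xi>"
proof -
  interpret s: bounded_bilinear "(*s) :: complex \<Rightarrow> complex^3 \<Rightarrow> complex^3"
    by (rule bounded_bilinear_vector_smult)
  have fb: "iter_deriv [b] f \<in> test_functions X"
    using test_functions_iter_deriv[OF f, of "[b]"] b by simp
  have df: "(f has_derivative frechet_derivative f (at z)) (at z)" for z
    using has_derivative_iter_deriv[of UNIV f "[]" z] f by (simp add: test_functions_def)
  define D where "D z v = cis (- (z \<bullet> \<xi>)) *s frechet_derivative f (at z) v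
    + (- (v \<bullet> \<xi>) *\<^sub>R (\<i> * cis (- (z \<bullet> \<xi>)))) *s f z" for z v
  have D: "((\<lambda>z. cis (- (z \<bullet> \<xi>)) *s f z) has_derivative D z) (at z)" for z
    unfolding D_def
    by (rule s.FDERIV[OF _ df]) (auto intro!: derivative_eq_intros)
  have eq: "D z b = cis (- (z \<bullet> \<xi>)) *s iter_deriv [b] f z
      + (- (\<i> * complex_of_real (b \<bullet> \<xi>))) *s (cis (- (z \<bullet> \<xi>)) *s f z)" for z
    by (simp add: D_def scaleR_conv_of_real vec_eq_iff)
  have "(LINT z|lborel. D z b) = 0"
  proof (rule integral_directional_derivative_eq_0[OF D])
    show "continuous_on UNIV (\<lambda>z. D z b)"
      unfolding eq using test_functionsD[OF f] test_functionsD[OF fb]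
      by (intro continuous_intros) simp_all
    show "compact (supp f)"
      using test_functionsD[OF f] by simp
  qed (simp add: not_in_supp)
  also have "(LINT z|lborel. D z b) = fourier (iter_deriv [b] f) \<xi>
      + (- (\<i> * complex_of_real (b \<bullet> \<xi>))) *s fourier f \<xi>"
    unfolding eq fourier_def
    using integrable_fourier_integrand[OF f, of \<xi>] integrable_fourier_integrand[OF fb, of \<xi>]
    by (simp only: Bochner_Integration.integral_add
        integral_bounded_linear[OF s.bounded_linear_right]
        integrable_bounded_linear[OF s.bounded_linear_right])
  finally show ?thesis
    by (simp add: vec_eq_iff)
qed

lemma norm_fourier_le: "norm (fourier f \<xi>) \<le> (LINT z|lborel. norm (f z))"
proof -
  have "norm (fourier f \<xi>) \<le> (LINT z|lborel. norm (cis (- (z \<bullet> \<xi>)) *s f z))"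
    unfolding fourier_def by (rule integral_norm_bound)
  then show ?thesis
    by (simp add: norm_vector_smult)
qed

text \<open>\<open>g\<close> is obtained from \<open>f\<close> by applying \<open>1 - \<partial>\<^sub>b\<^sup>2\<close> for all \<open>b \<in> B\<close>.\<close>

lemma fourier_times_polynomial:
  fixes f :: "'a::euclidean_space \<Rightarrow> complex^3"
  assumes f: "f \<in> test_functions X" and "B \<subseteq> Basis"
  shows "\<exists>g\<in>test_functions X. \<forall>\<xi>. fourier g \<xi> = (\<Prod>b\<in>B. 1 + (\<xi> \<bullet> b)\<^sup>2) *\<^sub>R fourier f \<xi>"
proof -
  have "finite B"
    using assms(2) finite_Basis finite_subset by blast
  then show ?thesis
    using assms(2)
  proof induction
    case empty
    show ?case
      using f by auto
  next
    case (insert b B)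
    then obtain g where g: "g \<in> test_functions X"
      and Fg: "\<And>\<xi>. fourier g \<xi> = (\<Prod>b\<in>B. 1 + (\<xi> \<bullet> b)\<^sup>2) *\<^sub>R fourier f \<xi>"
      by auto
    have b: "b \<in> Basis"
      using insert.prems by simp
    have g1: "iter_deriv [b] g \<in> test_functions X"
      using test_functions_iter_deriv[OF g, of "[b]"] b by simp
    have g2: "iter_deriv [b] (iter_deriv [b] g) \<in> test_functions X"
      using test_functions_iter_deriv[OF g1, of "[b]"] b by simp
    let ?h = "\<lambda>z. g z + (- 1) *\<^sub>R iter_deriv [b] (iter_deriv [b] g) z"
    \<comment> \<open>Two derivatives in direction \<open>b\<close> multiply the transform by the
      square of \<open>\<i> * (b \<bullet> \<xi>)\<close>, a negative real factor; subtracting them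
      therefore yields the new factor of the product.\<close>
    have "fourier ?h \<xi> = (1 + (\<xi> \<bullet> b)\<^sup>2) *\<^sub>R fourier g \<xi>" for \<xi>
      unfolding fourier_lincomb[OF g g2] fourier_directional_derivative[OF g1 b]
        fourier_directional_derivative[OF g b]
      by (simp add: vec_eq_iff scaleR_conv_of_real[where 'a=complex] power2_eq_square inner_commute algebra_simps)
    then have "fourier ?h \<xi> = (\<Prod>b\<in>insert b B. 1 + (\<xi> \<bullet> b)\<^sup>2) *\<^sub>R fourier f \<xi>" for \<xi>
      using insert.hyps by (simp add: Fg)
    then show ?case
      using test_functions_lincomb[OF g g2, of "- 1"] by blast
  qed
qed

text \<open>A weight in product form lets Tonelli reduce the integral to a power of the finite
  one-dimensional integral of \<open>inverse (1 + x\<^sup>2)\<close>.\<close>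

lemma integrable_prod_inverse_1_plus_square:
  "integrable lborel (\<lambda>\<xi>::'a::euclidean_space. \<Prod>b\<in>Basis. inverse (1 + (\<xi> \<bullet> b)\<^sup>2))"
proof (rule integrableI_nonneg)
  have "integrable lborel (\<lambda>x::real. inverse (1 + x\<^sup>2))"
    using integrable_inverse_1_plus_square by (simp add: set_integrable_def)
  then have "(\<integral>\<^sup>+x. ennreal (inverse (1 + x\<^sup>2)) \<partial>(lborel :: real measure)) < \<infinity>"
    by (subst nn_integral_eq_integral) simp_all
  then have "(\<Prod>b\<in>(Basis::'a set). \<integral>\<^sup>+x. ennreal (inverse (1 + x\<^sup>2)) \<partial>(lborel :: real measure)) < \<infinity>"
    by (simp add: power_less_top_ennreal)
  moreover have "(\<integral>\<^sup>+\<xi>. (\<Prod>b\<in>(Basis::'a set). ennreal (inverse (1 + (\<xi> \<bullet> b)\<^sup>2))) \<partial>lborel)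
      = (\<Prod>b\<in>(Basis::'a set). \<integral>\<^sup>+x. ennreal (inverse (1 + x\<^sup>2)) \<partial>lborel)"
    by (rule nn_integral_lborel_prod[where f = "\<lambda>_ x. ennreal (inverse (1 + x\<^sup>2))"]) simp_all
  ultimately show "(\<integral>\<^sup>+\<xi>. ennreal (\<Prod>b\<in>(Basis::'a set). inverse (1 + (\<xi> \<bullet> b)\<^sup>2)) \<partial>lborel) < \<infinity>"
    by (simp add: prod_ennreal)
qed (auto intro!: prod_nonneg)

text \<open>The integrand is jointly continuous in \<open>\<xi>\<close> and \<open>z\<close>, hence
  jointly measurable, and integrating out one variable preserves measurability in the other.\<close>

lemma borel_measurable_fourier:
  fixes f :: "'a::euclidean_space \<Rightarrow> complex^3"
  assumes f: "f \<in> test_functions X"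
  shows "fourier f \<in> borel_measurable borel"
proof -
  have "continuous_on UNIV (\<lambda>(\<xi>, z). cis (- (z \<bullet> \<xi>)) *s f z)"
    unfolding case_prod_beta
    using continuous_on_compose2[OF test_functionsD(3)[OF f] continuous_on_snd]
    by (auto intro!: continuous_intros)
  then have "(\<lambda>(\<xi>, z). cis (- (z \<bullet> \<xi>)) *s f z) \<in> borel_measurable (borel \<Otimes>\<^sub>M borel)"
    unfolding borel_prod by (rule borel_measurable_continuous_onI)
  then show ?thesis
    unfolding fourier_def[abs_def] by (intro lborel.borel_measurable_lebesgue_integral) simp
qed

text \<open>The transform times a positive polynomial is the transform of another test function
  \<open>g\<close>, and so is bounded by the integral of \<open>norm (g z)\<close>. Dividing by the
  polynomial leaves an integrable majorant.\<close>

lemma integrable_fourier: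
  fixes f :: "'a::euclidean_space \<Rightarrow> complex^3"
  assumes f: "f \<in> test_functions X"
  shows "integrable lborel (fourier f)"
proof -
  obtain g where Fg: "\<And>\<xi>. fourier g \<xi> = (\<Prod>b\<in>Basis. 1 + (\<xi> \<bullet> b)\<^sup>2) *\<^sub>R fourier f \<xi>"
    using fourier_times_polynomial[OF f, of Basis] by auto
  define M where "M = (LINT z|lborel. norm (g z))"
  have "norm (fourier f \<xi>) \<le> norm (M * (\<Prod>b\<in>Basis. inverse (1 + (\<xi> \<bullet> b)\<^sup>2)))" for \<xi>
  proof -
    have p: "(\<Prod>b\<in>Basis. 1 + (\<xi> \<bullet> b)\<^sup>2) > 0"
      by (intro prod_pos) (simp add: add_pos_nonneg)
    have "(\<Prod>b\<in>Basis. 1 + (\<xi> \<bullet> b)\<^sup>2) * norm (fourier f \<xi>) \<le> M"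
      using norm_fourier_le[of g \<xi>] p by (simp add: Fg M_def)
    then have "norm (fourier f \<xi>) \<le> M * inverse (\<Prod>b\<in>Basis. 1 + (\<xi> \<bullet> b)\<^sup>2)"
      using p by (simp add: divide_inverse[symmetric] pos_le_divide_eq mult.commute)
    then show ?thesis
      using abs_ge_self[of "M * inverse (\<Prod>b\<in>Basis. 1 + (\<xi> \<bullet> b)\<^sup>2)"]
      by (simp add: prod_inversef[of _ Basis, symmetric, unfolded o_def])
  qed
  then show ?thesis
    using borel_measurable_fourier[OF f]
    by (intro Bochner_Integration.integrable_bound[OF integrable_mult_right[OF integrable_prod_inverse_1_plus_square]])
       auto
qed


section \<open>Differences of pseudodifferential operators\<close>

lemma continuous_on_symbol:
  assumes "a \<in> symbols m"
  shows "continuous_on UNIV a"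
  using assms smooth_on_imp_continuous_on by (auto simp: symbols_def)

lemma symbols_bounded:
  assumes "a \<in> symbols 0"
  obtains C where "C \<ge> 0" "\<And>p. norm (a p) \<le> C"
proof -
  have "\<forall>vs\<in>lists Basis. \<forall>ws\<in>lists Basis. \<exists>C. \<forall>z \<xi>.
      norm (iter_deriv (map (\<lambda>v. (v, 0)) vs @ map (\<lambda>w. (0, w)) ws) a (z, \<xi>))
        \<le> C * (1 + norm \<xi>) powr (0 - real (length ws))"
    using assms unfolding symbols_def mem_Collect_eq by (elim conjE)
  from bspec[OF bspec[OF this lists.Nil] lists.Nil]
  obtain C where C: "\<And>z \<xi>. norm (a (z, \<xi>)) \<le> C * (1 + norm \<xi>) powr 0"
    by auto
  have "norm (a p) \<le> \<bar>C\<bar>" for p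
  proof -
    \<comment> \<open>Since \<open>0 powr 0\<close> is 0, evaluating the weight to 1 requires a
      nonzero base.\<close>
    have "1 + norm (snd p) \<noteq> 0"
      using norm_ge_zero[of "snd p"] by linarith
    then show ?thesis
      using C[of "fst p" "snd p"] by simp
  qed
  then show ?thesis
    using that[of "\<bar>C\<bar>"] by simp
qed

lemma symbols_diff:
  assumes a: "a \<in> symbols m" and b: "b \<in> symbols m"
  shows "(\<lambda>p. a p - b p) \<in> symbols m"
proof -
  have sa: "smooth_on UNIV a" and sb: "smooth_on UNIV b"
    using a b by (auto simp: symbols_def)
  have eq: "(\<lambda>p. a p - b p) = (\<lambda>p. a p + (- 1) *\<^sub>R b p)"
    by simp
  show ?thesis
    unfolding eq symbols_def
  proof (intro CollectI conjI ballI)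
    show "smooth_on UNIV (\<lambda>p. a p + (- 1) *\<^sub>R b p)"
      using sa sb by (intro smooth_on_lincomb) auto
  next
    fix vs ws :: "'a list"
    assume vs: "vs \<in> lists Basis" and ws: "ws \<in> lists Basis"
    let ?L = "map (\<lambda>v. (v, 0)) vs @ map (\<lambda>w. (0, w)) ws"
    let ?w = "\<lambda>\<xi>::'a. (1 + norm \<xi>) powr (m - real (length ws))"
    \<comment> \<open>The mixed list consists of basis vectors of the product space, so linearity of
      iterated derivatives applies and the two symbol estimates add up.\<close>
    have L: "?L \<in> lists Basis"
      using vs ws by (auto simp: Basis_prod_def)
    obtain C where C: "\<And>z \<xi>. norm (iter_deriv ?L a (z, \<xi>)) \<le> C * ?w \<xi>"
      using a vs ws unfolding symbols_def by blast
    obtain C' where C': "\<And>z \<xi>. norm (iter_deriv ?L b (z, \<xi>)) \<le> C' * ?w \<xi>"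
      using b vs ws unfolding symbols_def by blast
    have "norm (iter_deriv ?L (\<lambda>p. a p + (- 1) *\<^sub>R b p) (z, \<xi>)) \<le> (C + C') * ?w \<xi>" for z \<xi>
    proof -
      have "norm (iter_deriv ?L (\<lambda>p. a p + (- 1) *\<^sub>R b p) (z, \<xi>))
          = norm (iter_deriv ?L a (z, \<xi>) - iter_deriv ?L b (z, \<xi>))"
        using iter_deriv_lincomb[OF open_UNIV sa sb L, of "(z, \<xi>)" "- 1"] by simp
      also have "\<dots> \<le> norm (iter_deriv ?L a (z, \<xi>)) + norm (iter_deriv ?L b (z, \<xi>))"
        by (rule norm_triangle_ineq4)
      also have "\<dots> \<le> (C + C') * ?w \<xi>"
        using C[of z \<xi>] C'[of z \<xi>] by (simp add: distrib_right)
      finally show ?thesis .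
    qed
    then show "\<exists>C. \<forall>z \<xi>. norm (iter_deriv ?L (\<lambda>p. a p + (- 1) *\<^sub>R b p) (z, \<xi>)) \<le> C * ?w \<xi>"
      by blast
  qed
qed

lemma norm_matrix_vector_mult_le:
  obtains K where "K \<ge> 0" "\<And>(A :: complex^'n^'m) x. norm (A *v x) \<le> norm A * norm x * K"
proof -
  interpret bounded_bilinear "(*v) :: complex^'n^'m \<Rightarrow> complex^'n \<Rightarrow> complex^'m"
    by (rule bounded_bilinear_matrix_vector_mult)
  show ?thesis
    using nonneg_bounded that by blast
qed

text \<open>\<open>fourier f\<close> is known to be Borel measurable, so its value is treated as a
  third variable \<open>x\<close>: the integrand is a continuous function of
  \<open>((z, \<xi>), x)\<close> composed with a measurable map.\<close>

lemma borel_measurable_Op_integrand: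
  assumes a: "a \<in> symbols m" and f: "f \<in> test_functions X"
  shows "(\<lambda>(z, \<xi>). cis (z \<bullet> \<xi>) *s (a (z, \<xi>) *v fourier f \<xi>)) \<in> borel_measurable (borel \<Otimes>\<^sub>M borel)"
proof -
  have [measurable]: "fourier f \<in> borel_measurable borel"
    by (rule borel_measurable_fourier[OF f])
  have "continuous_on UNIV (\<lambda>((z, \<xi>), x). cis (z \<bullet> \<xi>) *s (a (z, \<xi>) *v x))"
    unfolding case_prod_beta
    using continuous_on_compose2[OF continuous_on_symbol[OF a] continuous_on_fst[OF continuous_on_id]]
    by (auto intro!: continuous_intros)
  then have [measurable]: "(\<lambda>((z, \<xi>), x). cis (z \<bullet> \<xi>) *s (a (z, \<xi>) *v x))
      \<in> borel_measurable ((borel \<Otimes>\<^sub>M borel) \<Otimes>\<^sub>M borel)"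
    unfolding borel_prod by (rule borel_measurable_continuous_onI)
  have "(\<lambda>p. (\<lambda>((z, \<xi>), x). cis (z \<bullet> \<xi>) *s (a (z, \<xi>) *v x)) (p, fourier f (snd p)))
      \<in> borel_measurable (borel \<Otimes>\<^sub>M borel)"
    by measurable
  then show ?thesis
    by (simp add: case_prod_unfold)
qed

text \<open>A symbol of order 0 is bounded, so the integrand is dominated by a multiple of
  \<open>norm (fourier f \<xi>)\<close> with a constant independent of \<open>z\<close>. The
  integral of this majorant is the uniform bound \<open>M\<close>.\<close>

lemma Op_integrand:
  assumes a: "a \<in> symbols 0" and f: "f \<in> test_functions X"
  obtains M where "\<And>z. integrable lborel (\<lambda>\<xi>. cis (z \<bullet> \<xi>) *s (a (z, \<xi>) *v fourier f \<xi>))"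
    "\<And>z. norm (LINT \<xi>|lborel. cis (z \<bullet> \<xi>) *s (a (z, \<xi>) *v fourier f \<xi>)) \<le> M"
proof -
  let ?F = "\<lambda>z \<xi>. cis (z \<bullet> \<xi>) *s (a (z, \<xi>) *v fourier f \<xi>)"
  obtain C where C: "C \<ge> 0" "\<And>p. norm (a p) \<le> C"
    using symbols_bounded[OF a] by blast
  obtain K where K: "K \<ge> 0" "\<And>(A :: complex^3^3) x. norm (A *v x) \<le> norm A * norm x * K"
    using norm_matrix_vector_mult_le by blast
  have bound: "norm (?F z \<xi>) \<le> C * K * norm (fourier f \<xi>)" for z \<xi>
  proof -
    have "norm (?F z \<xi>) \<le> norm (a (z, \<xi>)) * norm (fourier f \<xi>) * K"
      by (simp add: norm_vector_smult K(2))
    also have "\<dots> \<le> C * norm (fourier f \<xi>) * K"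
      by (intro mult_right_mono C K) simp
    finally show ?thesis
      by (simp add: mult.commute mult.left_commute)
  qed
  have intf: "integrable lborel (\<lambda>\<xi>. C * K * norm (fourier f \<xi>))"
    using integrable_fourier[OF f] by (intro integrable_mult_right integrable_norm)
  have int: "integrable lborel (?F z)" for z
  proof (rule Bochner_Integration.integrable_bound[OF intf])
    have "(\<lambda>\<xi>. (\<lambda>(z, \<xi>). ?F z \<xi>) (z, \<xi>)) \<in> borel_measurable borel"
      by (rule measurable_compose[OF _ borel_measurable_Op_integrand[OF a f]]) simp
    then show "?F z \<in> borel_measurable lborel"
      by simp
    show "AE \<xi> in lborel. norm (?F z \<xi>) \<le> norm (C * K * norm (fourier f \<xi>))"
      using bound C K by simp
  qed
  have "norm (LINT \<xi>|lborel. ?F z \<xi>) \<le> (LINT \<xi>|lborel. C * K * norm (fourier f \<xi>))" for z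
    using integral_norm_bound[of lborel "?F z"]
      integral_mono[OF integrable_norm[OF int] intf bound, of z] by linarith
  with int that show ?thesis
    by blast
qed

lemma Op_diff:
  assumes "a \<in> symbols 0" "b \<in> symbols 0" and f: "f \<in> test_functions X"
  shows "Op (\<lambda>p. a p - b p) f z = Op a f z - Op b f z"
proof -
  interpret s: bounded_bilinear "(*s) :: complex \<Rightarrow> complex^3 \<Rightarrow> complex^3"
    by (rule bounded_bilinear_vector_smult)
  interpret m: bounded_bilinear "(*v) :: complex^3^3 \<Rightarrow> complex^3 \<Rightarrow> complex^3"
    by (rule bounded_bilinear_matrix_vector_mult)
  have "integrable lborel (\<lambda>\<xi>. cis (z \<bullet> \<xi>) *s (a (z, \<xi>) *v fourier f \<xi>))"
       "integrable lborel (\<lambda>\<xi>. cis (z \<bullet> \<xi>) *s (b (z, \<xi>) *v fourier f \<xi>))"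
    using Op_integrand[OF assms(1) f] Op_integrand[OF assms(2) f] by blast+
  then show ?thesis
    unfolding Op_def m.diff_left s.diff_right
    by (simp add: scaleR_diff_right)
qed

text \<open>As a parameter integral \<open>Op a f\<close> is measurable, and it is bounded;
  multiplied by the integrable \<open>g\<close> it is integrable.\<close>

lemma integrable_smult_Op:
  fixes f :: "'a::euclidean_space \<Rightarrow> complex^3"
  assumes a: "a \<in> symbols 0" and f: "f \<in> test_functions X" and g: "g \<in> test_functions Y"
  shows "integrable lborel (\<lambda>z. g z *s Op a f z)"
proof -
  interpret s: bounded_bilinear "(*s) :: complex \<Rightarrow> complex^3 \<Rightarrow> complex^3"
    by (rule bounded_bilinear_vector_smult)
  let ?I = "\<lambda>z. LINT \<xi>|lborel. cis (z \<bullet> \<xi>) *s (a (z, \<xi>) *v fourier f \<xi>)"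
  let ?c = "1 / (2 * pi) ^ DIM('a)"
  obtain M where M: "\<And>z. norm (?I z) \<le> M"
    using Op_integrand[OF a f] by blast
  have I [measurable]: "?I \<in> borel_measurable borel"
    using borel_measurable_Op_integrand[OF a f]
    by (intro lborel.borel_measurable_lebesgue_integral) simp
  have gm: "g \<in> borel_measurable borel"
    using test_functionsD(3)[OF g] by (rule borel_measurable_continuous_onI)
  have "continuous_on UNIV (\<lambda>(c::complex, x::complex^3). c *s x)"
    unfolding case_prod_beta by (auto intro!: continuous_intros)
  then have "(\<lambda>(c::complex, x::complex^3). c *s x) \<in> borel_measurable (borel \<Otimes>\<^sub>M borel)"
    unfolding borel_prod by (rule borel_measurable_continuous_onI)
  from measurable_compose[OF measurable_Pair[OF gm I] this]
  have meas: "(\<lambda>z. g z *s ?I z) \<in> borel_measurable lborel"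
    by simp
  have "integrable lborel (\<lambda>z. g z *s ?I z)"
  proof (rule Bochner_Integration.integrable_bound[OF _ meas])
    show "integrable lborel (\<lambda>z. norm (g z) * M)"
      using integrable_test_function[OF g] by (intro integrable_mult_left integrable_norm)
    have "norm (g z *s ?I z) \<le> norm (norm (g z) * M)" for z
      using mult_left_mono[OF M[of z] norm_ge_zero[of "g z"]]
      by (simp only: norm_vector_smult real_norm_def)
    then show "AE z in lborel. norm (g z *s ?I z) \<le> norm (norm (g z) * M)"
      by simp
  qed
  \<comment> \<open>The estimate was made without the normalising power of \<open>2 * pi\<close>,
    which is restored here.\<close>
  then have "integrable lborel (\<lambda>z. ?c *\<^sub>R (g z *s ?I z))"
    by (rule integrable_scaleR_right)
  then show ?thesis
    by (simp add: Op_def s.scaleR_right)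
qed

lemma density_Op_diff:
  assumes a: "a \<in> symbols 0" and b: "b \<in> symbols 0"
    and f: "f \<in> test_functions X" and g: "g \<in> test_functions Y"
  shows "Defs.density (Op (\<lambda>p. a p - b p) f) g = Defs.density (Op a f) g - Defs.density (Op b f) g"
proof -
  interpret s: bounded_bilinear "(*s) :: complex \<Rightarrow> complex^3 \<Rightarrow> complex^3"
    by (rule bounded_bilinear_vector_smult)
  show ?thesis
    using integrable_smult_Op[OF a f g] integrable_smult_Op[OF b f g]
    by (simp add: Defs.density_def Op_diff[OF a b f] s.diff_right)
qed

section \<open>Linear combinations of smooth functionals and differences of distributions\<close>

lemma smooth_distribution_lincomb:
  assumes X: "open X" and "smooth_distribution X u" "smooth_distribution X v"
  shows "smooth_distribution X (\<lambda>\<phi>. u \<phi> + c *\<^sub>R v \<phi>)"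
proof -
  interpret s: bounded_bilinear "(*s) :: complex \<Rightarrow> complex^3 \<Rightarrow> complex^3"
    by (rule bounded_bilinear_vector_smult)
  obtain f g where f: "smooth_on X f" and u: "\<And>\<phi>. \<phi> \<in> test_functions X \<Longrightarrow> u \<phi> = Defs.density f \<phi>"
    and g: "smooth_on X g" and v: "\<And>\<phi>. \<phi> \<in> test_functions X \<Longrightarrow> v \<phi> = Defs.density g \<phi>"
    using assms(2,3) unfolding smooth_distribution_def by blast
  \<comment> \<open>Additivity of the integral needs both products with \<open>\<phi>\<close> to be
    integrable; they are, since \<open>supp \<phi>\<close> is compact in \<open>X\<close> and both
    densities are continuous there.\<close>
  have "u \<phi> + c *\<^sub>R v \<phi> = Defs.density (\<lambda>x. f x + c *\<^sub>R g x) \<phi>" if \<phi>: "\<phi> \<in> test_functions X" for \<phi>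
    using integrable_smult_test_function[OF \<phi> smooth_on_imp_continuous_on[OF f]]
      integrable_smult_test_function[OF \<phi> smooth_on_imp_continuous_on[OF g]]
    by (simp add: u[OF \<phi>] v[OF \<phi>] Defs.density_def s.add_right s.scaleR_right)
  then show ?thesis
    using smooth_on_lincomb[OF X f g] unfolding smooth_distribution_def by blast
qed

lemma open_chart_cylinder: "chart \<Gamma> \<kappa> V \<Longrightarrow> open (UNIV \<times> V)"
  by (simp add: chart_def open_Times)

lemma boundary_smooth_lincomb:
  assumes "boundary_smooth \<Gamma> u" "boundary_smooth \<Gamma> v"
  shows "boundary_smooth \<Gamma> (\<lambda>\<phi>. u \<phi> + c *\<^sub>R v \<phi>)"
  unfolding boundary_smooth_def
proof (intro allI impI)
  fix \<kappa> V assume "chart \<Gamma> \<kappa> V"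
  then have "smooth_distribution (UNIV \<times> V) (\<lambda>\<psi>. pull \<kappa> V u \<psi> + c *\<^sub>R pull \<kappa> V v \<psi>)"
    using assms by (intro smooth_distribution_lincomb open_chart_cylinder) (auto simp: boundary_smooth_def)
  then show "smooth_distribution (UNIV \<times> V) (pull \<kappa> V (\<lambda>\<phi>. u \<phi> + c *\<^sub>R v \<phi>))"
    by (simp add: pull_def)
qed

lemma boundary_smooth_add:
  "boundary_smooth \<Gamma> u \<Longrightarrow> boundary_smooth \<Gamma> v \<Longrightarrow> boundary_smooth \<Gamma> (\<lambda>\<phi>. u \<phi> + v \<phi>)"
  using boundary_smooth_lincomb[of \<Gamma> u v 1] by simp

lemma boundary_smooth_diff:
  "boundary_smooth \<Gamma> u \<Longrightarrow> boundary_smooth \<Gamma> v \<Longrightarrow> boundary_smooth \<Gamma> (\<lambda>\<phi>. u \<phi> - v \<phi>)"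
  using boundary_smooth_lincomb[of \<Gamma> u v "- 1"] by simp

lemma distribution_diff:
  assumes "distribution X u" "distribution X v"
  shows "distribution X (\<lambda>\<phi>. u \<phi> - v \<phi>)"
  unfolding distribution_def
proof (intro conjI ballI allI impI)
  fix \<phi> \<psi> :: "'a \<Rightarrow> complex" assume "\<phi> \<in> test_functions X" "\<psi> \<in> test_functions X"
  then show "u (\<lambda>x. \<phi> x + \<psi> x) - v (\<lambda>x. \<phi> x + \<psi> x) = u \<phi> - v \<phi> + (u \<psi> - v \<psi>)"
    using assms by (simp add: distribution_def)
next
  fix \<phi> :: "'a \<Rightarrow> complex" and c assume "\<phi> \<in> test_functions X"
  then show "u (\<lambda>x. c * \<phi> x) - v (\<lambda>x. c * \<phi> x) = c *s (u \<phi> - v \<phi>)"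
    using assms by (simp add: distribution_def vec_eq_iff algebra_simps)
next
  fix K assume K: "compact K \<and> K \<subseteq> X"
  let ?P = "\<lambda>N (\<phi> :: 'a \<Rightarrow> complex) B. supp \<phi> \<subseteq> K \<and>
    (\<forall>vs\<in>lists Basis. length vs \<le> N \<longrightarrow> (\<forall>x. norm (iter_deriv vs \<phi> x) \<le> B))"
  have bounds: "\<exists>C N. \<forall>\<phi>\<in>test_functions X. \<forall>B. ?P N \<phi> B \<longrightarrow> norm (w \<phi>) \<le> C * B"
    if "distribution X w" for w
    using that K unfolding distribution_def by (elim conjE allE[of _ K] impE) auto
  obtain C N where u: "\<forall>\<phi>\<in>test_functions X. \<forall>B. ?P N \<phi> B \<longrightarrow> norm (u \<phi>) \<le> C * B"
    using bounds[OF assms(1)] by (elim exE) (rule that)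
  obtain C' N' where v: "\<forall>\<phi>\<in>test_functions X. \<forall>B. ?P N' \<phi> B \<longrightarrow> norm (v \<phi>) \<le> C' * B"
    using bounds[OF assms(2)] by (elim exE) (rule that)
  \<comment> \<open>Control of derivatives up to the larger order gives control up to either order.
    As \<open>B\<close> is any common bound for these derivatives, the two constants add.\<close>
  have "norm (u \<phi> - v \<phi>) \<le> (C + C') * B"
    if "\<phi> \<in> test_functions X" "?P (max N N') \<phi> B" for \<phi> B
  proof -
    have le: "norm (iter_deriv vs \<phi> x) \<le> B" if "vs \<in> lists Basis" "length vs \<le> max N N'" for vs x
      using \<open>?P (max N N') \<phi> B\<close> that by blast
    have "norm (u \<phi>) \<le> C * B" "norm (v \<phi>) \<le> C' * B"
      using that(1) conjunct1[OF that(2)] by (auto intro!: u[rule_format] v[rule_format] le)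
    then show ?thesis
      using norm_triangle_ineq4[of "u \<phi>" "v \<phi>"] by (simp add: distrib_right)
  qed
  then show "\<exists>C N. \<forall>\<phi>\<in>test_functions X. \<forall>B. ?P N \<phi> B \<longrightarrow> norm (u \<phi> - v \<phi>) \<le> C * B"
    by blast
qed

lemma boundary_distribution_diff:
  assumes "boundary_distribution \<Gamma> u" "boundary_distribution \<Gamma> v"
  shows "boundary_distribution \<Gamma> (\<lambda>\<phi>. u \<phi> - v \<phi>)"
  unfolding boundary_distribution_def
proof (intro conjI ballI allI impI)
  fix \<kappa> V assume "chart \<Gamma> \<kappa> V"
  then have "distribution (UNIV \<times> V) (\<lambda>\<psi>. pull \<kappa> V u \<psi> - pull \<kappa> V v \<psi>)"
    using assms by (intro distribution_diff) (auto simp: boundary_distribution_def)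
  then show "distribution (UNIV \<times> V) (pull \<kappa> V (\<lambda>\<phi>. u \<phi> - v \<phi>))"
    by (simp add: pull_def)
qed (use assms in \<open>simp_all add: boundary_distribution_def vec_eq_iff algebra_simps\<close>)

section \<open>Closure of operators of order 0 under differences\<close>

lemma psido_tendsto:
  assumes "psido \<Gamma> m A" "\<And>n. compact_distribution \<Gamma> (H n)" "\<And>n. supported_before \<Gamma> T (H n)"
    and "compact_distribution \<Gamma> h" "\<And>\<phi>. \<phi> \<in> boundary_test \<Gamma> \<Longrightarrow> (\<lambda>n. H n \<phi>) \<longlonglongrightarrow> h \<phi>"
    and "\<phi> \<in> boundary_test \<Gamma>"
  shows "(\<lambda>n. A (H n) \<phi>) \<longlonglongrightarrow> A h \<phi>"
proof -
  have "\<forall>H h T. (\<forall>n. compact_distribution \<Gamma> (H n) \<and> supported_before \<Gamma> T (H n)) \<and>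
      compact_distribution \<Gamma> h \<and> (\<forall>\<phi>\<in>boundary_test \<Gamma>. (\<lambda>n. H n \<phi>) \<longlonglongrightarrow> h \<phi>) \<longrightarrow>
      (\<forall>\<phi>\<in>boundary_test \<Gamma>. (\<lambda>n::nat. A (H n) \<phi>) \<longlonglongrightarrow> A h \<phi>)"
    using assms(1) unfolding psido_def by (elim conjE)
  from this[rule_format, of H T h] show ?thesis
    using assms(2-) by blast
qed

lemma psido_symbol:
  assumes "psido \<Gamma> m A" "chart \<Gamma> \<kappa> V"
    and "\<phi> \<in> test_functions (UNIV \<times> V)" "\<psi> \<in> test_functions (UNIV \<times> V)"
  obtains a where "a \<in> symbols m"
    "\<And>f g. f \<in> test_functions UNIV \<Longrightarrow> g \<in> test_functions UNIV \<Longrightarrow>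
      pull \<kappa> V (A (chart_density \<kappa> (\<lambda>z. \<psi> z *s f z))) (\<lambda>z. \<phi> z * g z) = Defs.density (Op a f) g"
proof -
  have "\<exists>a\<in>symbols m. \<forall>f\<in>test_functions UNIV. \<forall>g\<in>test_functions UNIV.
      pull \<kappa> V (A (chart_density \<kappa> (\<lambda>z. \<psi> z *s f z))) (\<lambda>z. \<phi> z * g z) = Defs.density (Op a f) g"
    using assms unfolding psido_def by (elim conjE) simp
  then show ?thesis
    by (elim bexE) (rule that, assumption, drule bspec, assumption, drule bspec)
qed

text \<open>Every clause of \<open>psido\<close> is compatible with subtraction. In the local clause
  the difference of the two symbols is quantised, which rests on \<open>density_Op_diff\<close> and
  thus on order 0.\<close>

lemma psido_diff:
  assumes A: "psido \<Gamma> 0 A" and B: "psido \<Gamma> 0 B"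
  shows "psido \<Gamma> 0 (\<lambda>h \<phi>. A h \<phi> - B h \<phi>)"
  unfolding psido_def
proof (intro conjI)
  show "\<forall>h. compact_distribution \<Gamma> h \<longrightarrow> boundary_distribution \<Gamma> (\<lambda>\<phi>. A h \<phi> - B h \<phi>)"
    using A B boundary_distribution_diff by (simp add: psido_def)
  show "\<forall>h k. compact_distribution \<Gamma> h \<and> compact_distribution \<Gamma> k \<longrightarrow>
      (\<forall>\<phi>\<in>boundary_test \<Gamma>. A (\<lambda>\<psi>. h \<psi> + k \<psi>) \<phi> - B (\<lambda>\<psi>. h \<psi> + k \<psi>) \<phi>
         = A h \<phi> - B h \<phi> + (A k \<phi> - B k \<phi>))"
    using A B by (simp add: psido_def)
  show "\<forall>h c. compact_distribution \<Gamma> h \<longrightarrow> (\<forall>\<phi>\<in>boundary_test \<Gamma>.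
      A (\<lambda>\<psi>. c *s h \<psi>) \<phi> - B (\<lambda>\<psi>. c *s h \<psi>) \<phi> = c *s (A h \<phi> - B h \<phi>))"
    using A B by (simp add: psido_def vec_eq_iff right_diff_distrib)
  show "\<forall>H h T. (\<forall>n. compact_distribution \<Gamma> (H n) \<and> supported_before \<Gamma> T (H n)) \<and>
      compact_distribution \<Gamma> h \<and> (\<forall>\<phi>\<in>boundary_test \<Gamma>. (\<lambda>n. H n \<phi>) \<longlonglongrightarrow> h \<phi>) \<longrightarrow>
      (\<forall>\<phi>\<in>boundary_test \<Gamma>. (\<lambda>n::nat. A (H n) \<phi> - B (H n) \<phi>) \<longlonglongrightarrow> A h \<phi> - B h \<phi>)"
    by (intro allI impI ballI tendsto_diff psido_tendsto[OF A] psido_tendsto[OF B]) auto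
  show "\<forall>\<kappa> V \<phi> \<psi>. chart \<Gamma> \<kappa> V \<and> \<phi> \<in> test_functions (UNIV \<times> V) \<and> \<psi> \<in> test_functions (UNIV \<times> V) \<longrightarrow>
      (\<exists>a\<in>symbols 0. \<forall>f\<in>test_functions UNIV. \<forall>g\<in>test_functions UNIV.
         pull \<kappa> V (\<lambda>\<phi>'. A (chart_density \<kappa> (\<lambda>z. \<psi> z *s f z)) \<phi>' - B (chart_density \<kappa> (\<lambda>z. \<psi> z *s f z)) \<phi>')
           (\<lambda>z. \<phi> z * g z) = Defs.density (Op a f) g)"
  proof (intro allI impI)
    fix \<kappa> V and \<phi> \<psi> :: "real \<times> (real^2) \<Rightarrow> complex"
    assume "chart \<Gamma> \<kappa> V \<and> \<phi> \<in> test_functions (UNIV \<times> V) \<and> \<psi> \<in> test_functions (UNIV \<times> V)"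
    then have asm: "chart \<Gamma> \<kappa> V" "\<phi> \<in> test_functions (UNIV \<times> V)" "\<psi> \<in> test_functions (UNIV \<times> V)"
      by blast+
    let ?F = "\<lambda>f. chart_density \<kappa> (\<lambda>z. \<psi> z *s f z)"
    \<comment> \<open>Both symbols are taken for the same chart and the same cutoffs, so they can be
      subtracted.\<close>
    obtain a where a: "a \<in> symbols 0" "\<And>f g. f \<in> test_functions UNIV \<Longrightarrow> g \<in> test_functions UNIV \<Longrightarrow>
        pull \<kappa> V (A (?F f)) (\<lambda>z. \<phi> z * g z) = Defs.density (Op a f) g"
      using psido_symbol[OF A asm] by blast
    obtain b where b: "b \<in> symbols 0" "\<And>f g. f \<in> test_functions UNIV \<Longrightarrow> g \<in> test_functions UNIV \<Longrightarrow>
        pull \<kappa> V (B (?F f)) (\<lambda>z. \<phi> z * g z) = Defs.density (Op b f) g"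
      using psido_symbol[OF B asm] by blast
    have "pull \<kappa> V (\<lambda>\<phi>'. A (?F f) \<phi>' - B (?F f) \<phi>') (\<lambda>z. \<phi> z * g z)
        = Defs.density (Op (\<lambda>p. a p - b p) f) g"
      if f: "f \<in> test_functions UNIV" and g: "g \<in> test_functions UNIV" for f g
      using a(2)[OF f g] b(2)[OF f g] density_Op_diff[OF a(1) b(1) f g] by (simp add: pull_def)
    then show "\<exists>a\<in>symbols 0. \<forall>f\<in>test_functions UNIV. \<forall>g\<in>test_functions UNIV.
        pull \<kappa> V (\<lambda>\<phi>'. A (?F f) \<phi>' - B (?F f) \<phi>') (\<lambda>z. \<phi> z * g z) = Defs.density (Op a f) g"
      using symbols_diff[OF a(1) b(1)] by blast
  qed
qed

section \<open>The relation between transmission and reflection\<close>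

text \<open>For a given incident trace \<open>h\<close> a single scattering solution determines both
  operators, so continuity of the displacement links \<open>T h\<close> to
  \<open>R h\<close>.\<close>

lemma transmission_minus_reflection:
  assumes R: "reflection_operator \<Omega> \<Gamma> \<nu> Q R" and T: "transmission_operator \<Omega> \<Gamma> \<nu> Q T"
    and h: "compact_distribution \<Gamma> h" "boundary_wave_front \<Gamma> \<nu> h \<subseteq> hyperbolic \<Gamma> \<nu> Q"
  shows "boundary_smooth \<Gamma> (\<lambda>\<phi>. T h \<phi> - (h \<phi> + R h \<phi>))"
proof -
  \<comment> \<open>Existence of a solution with incident trace \<open>h\<close> is part of what
    \<open>reflection_operator\<close> asserts.\<close>
  obtain uI uR uT hR hT where s: "scattering_solution \<Omega> \<Gamma> \<nu> Q uI uR uT h hR hT"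
    using R h unfolding reflection_operator_def by blast
  have hR: "boundary_smooth \<Gamma> (\<lambda>\<phi>. hR \<phi> - R h \<phi>)"
    using R h s unfolding reflection_operator_def by blast
  have hT: "boundary_smooth \<Gamma> (\<lambda>\<phi>. hT \<phi> - T h \<phi>)"
    using T h s unfolding transmission_operator_def by blast
  have "boundary_smooth \<Gamma> (\<lambda>\<phi>. h \<phi> + hR \<phi> - hT \<phi>)"
    using s unfolding scattering_solution_def by blast
  \<comment> \<open>In \<open>(hR - R h) - (hT - T h) - (h + hR - hT)\<close> the traces
    \<open>hR\<close> and \<open>hT\<close> cancel.\<close>
  from boundary_smooth_diff[OF boundary_smooth_diff[OF hR hT] this] show ?thesis
    by (simp add: algebra_simps)
qed

theorem corollary1p7:
  fixes \<Omega> \<Gamma> :: "(real^3) set" and \<nu> :: "real^3 \<Rightarrow> real^3"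
    and Q Q' :: elastic
    and R R' T T' :: boundary_op
  assumes "interface_geometry \<Omega> \<Gamma> \<nu>"
    and "elastic_parameters \<Omega> \<Gamma> Q" and "elastic_parameters \<Omega> \<Gamma> Q'"
    and "reflection_operator \<Omega> \<Gamma> \<nu> Q R" and "reflection_operator \<Omega> \<Gamma> \<nu> Q' R'"
    and "transmission_operator \<Omega> \<Gamma> \<nu> Q T" and "transmission_operator \<Omega> \<Gamma> \<nu> Q' T'"
    and "equal_mod_smoothing \<Gamma> \<nu> (hyperbolic \<Gamma> \<nu> Q \<inter> hyperbolic \<Gamma> \<nu> Q') R R'"
    and "\<forall>x\<in>closure (region \<Omega> \<Gamma> Minus).
           c_P Q Minus x = c_P Q' Minus x \<and> c_S Q Minus x = c_S Q' Minus x \<and>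
           rho Q Minus x = rho Q' Minus x"
  shows "equal_mod_smoothing \<Gamma> \<nu> (hyperbolic \<Gamma> \<nu> Q \<inter> hyperbolic \<Gamma> \<nu> Q') T T'"
  unfolding equal_mod_smoothing_def
proof (intro allI impI)
  fix K assume K: "compact_cone K \<and> K \<subseteq> hyperbolic \<Gamma> \<nu> Q \<inter> hyperbolic \<Gamma> \<nu> Q'"
  obtain B B' where B: "psido \<Gamma> 0 B" "represents \<Gamma> \<nu> K B R"
    and B': "psido \<Gamma> 0 B'" "represents \<Gamma> \<nu> K B' R'"
    and smoothing: "psido_smoothing \<Gamma> (\<lambda>h \<phi>. B h \<phi> - B' h \<phi>)"
    using assms(8) K unfolding equal_mod_smoothing_def by blast
  obtain A where A: "psido \<Gamma> 0 A" "represents \<Gamma> \<nu> K A T"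
    using assms(6) K unfolding transmission_operator_def microlocal_psido_def by blast
  \<comment> \<open>Chosen so that \<open>A - ?A'\<close> is exactly \<open>B - B'\<close>, which is
    smoothing; it remains to see that this operator represents \<open>T'\<close>.\<close>
  let ?A' = "\<lambda>h \<phi>. A h \<phi> - (B h \<phi> - B' h \<phi>)"
  have "psido \<Gamma> 0 ?A'"
    by (intro psido_diff A B B')
  moreover have "represents \<Gamma> \<nu> K ?A' T'"
    unfolding represents_def
  proof (intro allI impI)
    fix h assume h: "compact_distribution \<Gamma> h \<and> boundary_wave_front \<Gamma> \<nu> h \<subseteq> K"
    \<comment> \<open>The speeds inside the interface may differ, and with them the two hyperbolic
      sets. As \<open>K\<close> lies in both, \<open>h\<close> is admissible for all four
      operators.\<close>
    then have hyp: "boundary_wave_front \<Gamma> \<nu> h \<subseteq> hyperbolic \<Gamma> \<nu> Q"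
      "boundary_wave_front \<Gamma> \<nu> h \<subseteq> hyperbolic \<Gamma> \<nu> Q'"
      using K by blast+
    have "boundary_smooth \<Gamma> (\<lambda>\<phi>. A h \<phi> - T h \<phi>)" "boundary_smooth \<Gamma> (\<lambda>\<phi>. B h \<phi> - R h \<phi>)"
      "boundary_smooth \<Gamma> (\<lambda>\<phi>. B' h \<phi> - R' h \<phi>)"
      using A(2) B(2) B'(2) h unfolding represents_def by blast+
    \<comment> \<open>The combination is \<open>(A h - T h) - ((B h - R h) - (B' h - R' h))\<close>
      plus \<open>(T h - (h + R h)) - (T' h - (h + R' h))\<close>; here \<open>h\<close>,
      \<open>T h\<close>, \<open>R h\<close> and \<open>R' h\<close> cancel.\<close>
    from boundary_smooth_add[OF
        boundary_smooth_diff[OF this(1) boundary_smooth_diff[OF this(2,3)]]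
        boundary_smooth_diff[OF
          transmission_minus_reflection[OF assms(4,6) conjunct1[OF h] hyp(1)]
          transmission_minus_reflection[OF assms(5,7) conjunct1[OF h] hyp(2)]]]
    show "boundary_smooth \<Gamma> (\<lambda>\<phi>. ?A' h \<phi> - T' h \<phi>)"
      by (simp add: algebra_simps)
  qed
  moreover have "psido_smoothing \<Gamma> (\<lambda>h \<phi>. A h \<phi> - ?A' h \<phi>)"
    using smoothing by simp
  ultimately show "\<exists>A A'. psido \<Gamma> 0 A \<and> represents \<Gamma> \<nu> K A T \<and> psido \<Gamma> 0 A' \<and> represents \<Gamma> \<nu> K A' T' \<and>
      psido_smoothing \<Gamma> (\<lambda>h \<phi>. A h \<phi> - A' h \<phi>)"
    using A by blast
qed

end
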